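(* Let $D$ be a strongly connected balanced bipartite digraph of order $2a$, where $a\geq 3$, and let $k$ be an integer satisfying $\max\{1,\frac{a}{4}\}<k\leq\frac{a}{2}$. Suppose that for every dominated pair $\{u,v\}$ of vertices in $D$, \[ d(u)\geq 2a-k\ \text{and}\ d(v)\geq a+k,\quad\text{or}\quad d(u)\geq a+k\ \text{and}\ d(v)\geq 2a-k. \] Then $D$ is either bipancyclic or a directed cycle of length $2a$.
   Context: Digraphs have no loops and no multiple arcs. For a vertex $v$, $d(v)=d^+(v)+d^-(v)$ (out-degree plus in-degree). A pair of distinct vertices $\{u,v\}$ is dominated if there is a vertex $w$ with $wu$ and $wv$ both arcs of $D$. Balanced bipartite: two partite sets of equal size. Bipancyclic: contains directed cycles of all even lengths $2,4,\dots,2a$. *)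

theory Defs
  imports Complex_Main "Graph_Theory.Graph_Theory"
begin

definition total_degree :: "('a, 'b) pre_digraph \<Rightarrow> 'a \<Rightarrow> nat" where
  "total_degree D v = out_degree D v + in_degree D v"

definition balanced_bipartite :: "('a, 'b) pre_digraph \<Rightarrow> bool" where
  "balanced_bipartite D \<longleftrightarrow>
     (\<exists>X Y. verts D = X \<union> Y \<and> X \<inter> Y = {} \<and> card X = card Y \<and>
        (\<forall>e \<in> arcs D. tail D e \<in> X \<and> head D e \<in> Y \<or> tail D e \<in> Y \<and> head D e \<in> X))"

definition dominated_pair :: "('a, 'b) pre_digraph \<Rightarrow> 'a \<Rightarrow> 'a \<Rightarrow> bool" where
  "dominated_pair D u v \<longleftrightarrow> u \<noteq> v \<and> (\<exists>w. w \<rightarrow>\<^bsub>D\<^esub> u \<and> w \<rightarrow>\<^bsub>D\<^esub> v)"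

(* A library cycle is a nonempty closed walk, given by its list of arcs, without repeated vertices;
   its length is the number of arcs, and u, v, u is a cycle of length 2. *)
definition bipancyclic :: "('a, 'b) pre_digraph \<Rightarrow> bool" where
  "bipancyclic D \<longleftrightarrow>
     (\<forall>n. even n \<and> 2 \<le> n \<and> n \<le> card (verts D) \<longrightarrow> (\<exists>p. pre_digraph.cycle D p \<and> length p = n))"

(* The whole digraph is a cycle: there are no vertices or arcs outside p. *)
definition is_directed_cycle :: "('a, 'b) pre_digraph \<Rightarrow> nat \<Rightarrow> bool" where
  "is_directed_cycle D n \<longleftrightarrow>
     (\<exists>p. pre_digraph.cycle D p \<and> length p = n \<and> arcs D = set p \<and> verts D = tail D ` set p)"

end

(*
  If some vertex lies in no dominated pair, then, since k > 1, its in-neighbours have this property as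
  well, so all out-degrees are 1 and D is a directed cycle. Otherwise every degree is at least a + k,
  and the vertices of degree below 2 a - k have pairwise disjoint in-neighbourhoods.

  Hall's theorem gives a cycle factor, encoded as a permutation f along arcs. If C is a union of cycles
  of f, if u lies in C and w does not, and if u -> f w and w -> f u, then exchanging f u and f w merges
  two cycles. So in a factor with as few cycles as possible at most half of the arcs between C and its
  complement are present, and for the smaller of the two this contradicts the degree bounds. The only case without slack is
  a = 2 k with both parts complete, where f can be rerouted freely inside each of them.

  On a Hamiltonian cycle f count the vertices v with v -> f^t v. Pairing t with 2 a + 4 - t yields
  z -> f^t z and f^(t-2) z -> f^2 z for some t, that is, two disjoint cycles missing only f z and
  f^(t-1) z, with t not close to a. These merge by the same count. A missed vertex has at least a arcs
  to and from the resulting cycle of length 2 a - 2, hence lies on cycles of all lengths up to 2 a - 2.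
*)

theory Submission
  imports Defs "HOL-Combinatorics.Transposition"
begin

section \<open>Cycle factors\<close>

text \<open>The obstacle is that a vertex may have degree only \<open>a + k\<close>, possibly far
  below \<open>2 * a - k\<close>. The compensation: no vertex has two such low out-neighbours, so l
  low vertices in a set cost each vertex l - 1 potential arcs into it. For p vertices on one side of
  C the balance of loss and gain is affine in l from l = 1 on, so l = 0, l = 1 and l = p decide.

  "Half" comes from a pairing: the arcs u -> f w and w -> f u, over all u in C and w outside,
  exhaust the arcs between C and its complement, and a pair with both arcs present allows a merge.

  The number 2 a + 4 - t makes the lengths fit: an arc over distance t closes a cycle of 2 a + 1 - t
  vertices, one over 2 a + 4 - t closes a cycle of t - 3 vertices, 2 a - 2 in all. Summing over
  these pairs bounds the number of arcs by exactly a (a + 2), while degrees of at least a + 2, one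
  of them larger, give more. For a = 4 no degree need be larger, so that case is treated by
  hand.\<close>

lemma hall_marriage:
  fixes N :: "'a \<Rightarrow> 'b set"
  assumes "finite A" and "\<And>a. a \<in> A \<Longrightarrow> finite (N a)"
    and "\<And>T. T \<subseteq> A \<Longrightarrow> card T \<le> card (\<Union>(N ` T))"
  shows "\<exists>f. inj_on f A \<and> (\<forall>a\<in>A. f a \<in> N a)"
  using assms
proof (induction "card A" arbitrary: A N rule: less_induct)
  case less
  show ?case
  proof (cases "A = {}")
    case False
    then obtain a where a: "a \<in> A" by blast
    \<comment> \<open>A critical proper subset \<open>T\<close> splits the problem: \<open>T\<close>
      is matched inside its neighbourhood \<open>U\<close>, the rest outside \<open>U\<close>.
      Without a critical subset, any single choice leaves Hall's condition intact for the
      rest.\<close>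
    show ?thesis
    proof (cases "\<exists>T. T \<subset> A \<and> T \<noteq> {} \<and> card T = card (\<Union>(N ` T))")
      case True
      then obtain T where T: "T \<subset> A" "T \<noteq> {}" "card T = card (\<Union>(N ` T))" by blast
      define U where "U = \<Union>(N ` T)"
      have finT: "finite T" using T less.prems(1) by (meson finite_subset psubset_imp_subset)
      have finU: "finite U" unfolding U_def using finT less.prems(2) T(1) by blast
      have "card T < card A" using T(1) less.prems(1) by (rule psubset_card_mono[rotated])
      then have "\<exists>f. inj_on f T \<and> (\<forall>a\<in>T. f a \<in> N a)"
        using less.hyps[of T N] finT T(1) less.prems by (metis psubset_imp_subset subset_trans subsetD)
      then obtain f where f: "inj_on f T" "\<forall>a\<in>T. f a \<in> N a" by blast
      have "card (A - T) < card A"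
        using T less.prems(1) by (metis Diff_subset card_Diff_subset card_gt_0_iff diff_less finT
            finite_subset psubset_imp_subset psubset_card_mono less_nat_zero_code gr0I)
      moreover have "card R \<le> card (\<Union>((\<lambda>a. N a - U) ` R))" if R: "R \<subseteq> A - T" for R
      proof -
        have finR: "finite R" using R less.prems(1) finite_subset by blast
        have fin: "finite (\<Union>((\<lambda>a. N a - U) ` R))" using finR R less.prems(2) by blast
        have "card R + card T = card (R \<union> T)"
          using R finR finT by (subst card_Un_disjoint) auto
        also have "\<dots> \<le> card (\<Union>(N ` (R \<union> T)))"
          by (rule less.prems(3)) (use R T in auto)
        also have "\<Union>(N ` (R \<union> T)) = \<Union>((\<lambda>a. N a - U) ` R) \<union> U" by (auto simp: U_def)
        also have "card \<dots> \<le> card (\<Union>((\<lambda>a. N a - U) ` R)) + card U" by (rule card_Un_le)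
        finally show ?thesis using T(3) by (simp add: U_def)
      qed
      ultimately have "\<exists>g. inj_on g (A - T) \<and> (\<forall>a\<in>A - T. g a \<in> N a - U)"
        by (intro less.hyps) (use less.prems in auto)
      then obtain g where g: "inj_on g (A - T)" "\<forall>a\<in>A - T. g a \<in> N a - U" by blast
      define h where "h = (\<lambda>x. if x \<in> T then f x else g x)"
      have "f x \<in> U" if "x \<in> T" for x using f that by (auto simp: U_def)
      then have "inj_on h A" using f(1) g unfolding h_def inj_on_def by (metis DiffI DiffE)
      moreover have "\<forall>a\<in>A. h a \<in> N a" using f(2) g(2) by (auto simp: h_def)
      ultimately show ?thesis by blast
    next
      case False
      have "card {a} \<le> card (\<Union>(N ` {a}))" by (rule less.prems(3)) (use a in auto)
      then obtain b where b: "b \<in> N a" by fastforce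
      have "card (A - {a}) < card A" using a less.prems(1) by (meson card_Diff1_less)
      moreover have "card R \<le> card (\<Union>((\<lambda>x. N x - {b}) ` R))" if R: "R \<subseteq> A - {a}" for R
      proof (cases "R = {}")
        case ne: False
        have "R \<subset> A" using R a by blast
        then have "card R < card (\<Union>(N ` R))"
          using False ne less.prems(3)[of R] by (metis le_neq_implies_less psubset_imp_subset)
        moreover have "\<Union>((\<lambda>x. N x - {b}) ` R) = \<Union>(N ` R) - {b}" by auto
        ultimately show ?thesis
          by (metis One_nat_def Suc_leI card_Diff_singleton_if diff_Suc_1 diff_le_mono less_imp_le_nat)
      qed auto
      ultimately have "\<exists>g. inj_on g (A - {a}) \<and> (\<forall>x\<in>A - {a}. g x \<in> N x - {b})"
        by (intro less.hyps) (use less.prems in auto)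
      then obtain g where g: "inj_on g (A - {a})" "\<forall>x\<in>A - {a}. g x \<in> N x - {b}" by blast
      have "inj_on (g(a := b)) A" using g by (auto simp: inj_on_def)
      moreover have "\<forall>x\<in>A. (g(a := b)) x \<in> N x" using g(2) b by auto
      ultimately show ?thesis by blast
    qed
  qed auto
qed

text \<open>For a permutation of a finite set these are the unions of cycles, so c cycles give 2^c
  of them. Their number stands in for the number of cycles when a factor is minimised.\<close>

definition closed_sets :: "('a \<Rightarrow> 'a) \<Rightarrow> 'a set \<Rightarrow> 'a set set" where
  "closed_sets f V = {S. S \<subseteq> V \<and> f ` S \<subseteq> S}"

definition cycle_factor :: "('a \<Rightarrow> 'a \<Rightarrow> bool) \<Rightarrow> 'a set \<Rightarrow> ('a \<Rightarrow> 'a) \<Rightarrow> bool" where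
  "cycle_factor E V f \<longleftrightarrow> bij_betw f V V \<and> (\<forall>v\<in>V. E v (f v))"

text \<open>A cycle through all of \<open>V\<close>: a cycle factor whose successor permutation has one orbit.\<close>
definition spanning_cycle :: "('a \<Rightarrow> 'a \<Rightarrow> bool) \<Rightarrow> 'a set \<Rightarrow> ('a \<Rightarrow> 'a) \<Rightarrow> bool" where
  "spanning_cycle E V f \<longleftrightarrow> cycle_factor E V f \<and> closed_sets f V \<subseteq> {{}, V}"

lemma closed_image_eq:
  assumes "bij_betw f V V" "finite V" "S \<in> closed_sets f V"
  shows "f ` S = S"
proof -
  have "S \<subseteq> V" "f ` S \<subseteq> S" using assms(3) by (auto simp: closed_sets_def)
  moreover have "inj_on f S" using assms(1) \<open>S \<subseteq> V\<close> by (meson bij_betw_def inj_on_subset)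
  ultimately show ?thesis using assms(2)
    by (metis card_image card_subset_eq finite_subset)
qed

lemma closed_sets_Diff:
  assumes "bij_betw f V V" "finite V" "S \<in> closed_sets f V"
  shows "V - S \<in> closed_sets f V"
proof -
  have S: "f ` S = S" "S \<subseteq> V" using closed_image_eq[OF assms] assms(3) by (auto simp: closed_sets_def)
  have "inj_on f V" "f ` V = V" using assms(1) by (auto simp: bij_betw_def)
  then have "f ` (V - S) = V - S" using S by (metis inj_on_image_set_diff Diff_subset order_refl)
  then show ?thesis by (auto simp: closed_sets_def)
qed

lemma closed_sets_bij_betw:
  assumes "bij_betw f V V" "finite V" "S \<in> closed_sets f V"
  shows "bij_betw f S S"
  using closed_image_eq[OF assms] assms by (auto simp: closed_sets_def bij_betw_def intro: inj_on_subset)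

lemma cycle_factor_closed:
  assumes "cycle_factor E V f" "finite V" "S \<in> closed_sets f V"
  shows "cycle_factor E S f"
  using closed_sets_bij_betw[of f V S] assms by (auto simp: cycle_factor_def closed_sets_def)

section \<open>Merging cycles by exchanging two successors\<close>

lemma swap_bij_betw:
  assumes "bij_betw f V V" "u \<in> V" "w \<in> V"
  shows "bij_betw (f(u := f w, w := f u)) V V"
proof -
  have 1: "inj_on (f(u := f w, w := f u)) V"
    using assms by (auto simp: inj_on_def bij_betw_def)
  have "x \<in> (f(u := f w, w := f u)) ` V" if "x \<in> V" for x
  proof -
    obtain v where v: "v \<in> V" "x = f v" using assms(1) \<open>x \<in> V\<close> by (metis bij_betw_def imageE)
    consider "v = u" | "v = w" | "v \<noteq> u" "v \<noteq> w" by blast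
    then show ?thesis
    proof cases
      case 1 then show ?thesis using v assms by (auto intro!: image_eqI[of _ _ w])
    next
      case 2 then show ?thesis using v assms by (auto intro!: image_eqI[of _ _ u])
    next
      case 3 then show ?thesis using v by (auto intro!: image_eqI[of _ _ v])
    qed
  qed
  moreover have "(f(u := f w, w := f u)) ` V \<subseteq> V"
    using assms by (auto simp: bij_betw_def)
  ultimately show ?thesis using 1 by (auto simp: bij_betw_def)
qed

lemma swap_factor:
  assumes "cycle_factor E V f" "u \<in> V" "w \<in> V" "E u (f w)" "E w (f u)"
  shows "cycle_factor E V (f(u := f w, w := f u))"
  using assms swap_bij_betw[of f V u w] by (auto simp: cycle_factor_def)

text \<open>If \<open>w\<close> were missing, the exchange would change nothing on
  \<open>S \<inter> C\<close>, making this set a union of cycles of \<open>f\<close>. But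
  \<open>u\<close> is now sent to \<open>f w\<close>, which then lies in
  \<open>S \<inter> C\<close>, and the only preimage of \<open>f w\<close> under \<open>f\<close> is
  \<open>w\<close>.\<close>

lemma swap_closed_mem:
  assumes "bij_betw f V V" "finite V" "C \<in> closed_sets f V" "w \<in> C" "u \<in> V - C"
    and S: "S \<in> closed_sets (f(u := f w, w := f u)) V" and "u \<in> S"
  shows "w \<in> S"
proof (rule ccontr)
  assume w: "w \<notin> S"
  have fS: "(f(u := f w, w := f u)) v \<in> S" if "v \<in> S" for v
    using S that unfolding closed_sets_def by blast
  have fC: "f v \<in> C" if "v \<in> C" for v using assms(3) that by (auto simp: closed_sets_def)
  have "f v \<in> S \<inter> C" if "v \<in> S \<inter> C" for v
  proof -
    have "v \<noteq> u" "v \<noteq> w" using that w assms(5) by auto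
    then show ?thesis using fS[of v] fC[of v] that by auto
  qed
  then have "S \<inter> C \<in> closed_sets f V" using S by (auto simp: closed_sets_def)
  then have eq: "f ` (S \<inter> C) = S \<inter> C" using assms(1,2) closed_image_eq by blast
  have "u \<noteq> w" using assms(4,5) by blast
  then have "f w \<in> S \<inter> C" using fS[OF \<open>u \<in> S\<close>] fC[OF assms(4)] by auto
  then obtain v where "v \<in> S \<inter> C" "f w = f v" using eq by (metis imageE)
  moreover have "w \<in> V" "v \<in> V" using assms(3,4) calculation(1) by (auto simp: closed_sets_def)
  ultimately have "v = w" using assms(1) by (metis bij_betw_def inj_onD)
  then show False using w \<open>v \<in> S \<inter> C\<close> by blast
qed

text \<open>Exchanging two successors from different orbits merges these orbits.\<close>
lemma swap_closed_sets:
  assumes "bij_betw f V V" "finite V" "C \<in> closed_sets f V" "u \<in> C" "w \<in> V - C"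
  shows "closed_sets (f(u := f w, w := f u)) V \<subseteq> closed_sets f V - {C}"
proof
  fix S assume S: "S \<in> closed_sets (f(u := f w, w := f u)) V"
  have ne: "u \<noteq> w" using assms by blast
  have uV: "u \<in> V" using assms(3,4) by (auto simp: closed_sets_def)
  have sym: "f(u := f w, w := f u) = f(w := f u, u := f w)" using ne by (simp add: fun_upd_twist)
  have uw: "w \<in> S" if "u \<in> S"
    using swap_closed_mem[OF assms(1,2) closed_sets_Diff[OF assms(1-3)], of w u S] S that assms uV by auto
  have wu: "u \<in> S" if "w \<in> S"
    using swap_closed_mem[OF assms(1,2,3,4,5), of S] S that sym by auto
  have fS: "(f(u := f w, w := f u)) v \<in> S" if "v \<in> S" for v
    using S that unfolding closed_sets_def by blast
  have "f v \<in> S" if "v \<in> S" for v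
    using fS[of v] fS[of u] fS[of w] uw wu that ne by (cases "v = u"; cases "v = w") auto
  then have "S \<in> closed_sets f V" using S by (auto simp: closed_sets_def)
  moreover have "S \<noteq> C" using uw assms by blast
  ultimately show "S \<in> closed_sets f V - {C}" by blast
qed

lemma finite_closed_sets: "finite V \<Longrightarrow> finite (closed_sets f V)"
  by (rule finite_subset[of _ "Pow V"]) (auto simp: closed_sets_def)

text \<open>The glued permutation has only \<open>{}\<close>, \<open>C\<close>, \<open>D\<close> and
  \<open>C \<union> D\<close> as closed sets. The exchange destroys \<open>C\<close> and, since
  complements of closed sets are closed, also \<open>D\<close>.\<close>

lemma merge_spanning_cycles:
  assumes f: "spanning_cycle E C f" and g: "spanning_cycle E D g"
    and fin: "finite C" "finite D" and disj: "C \<inter> D = {}"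
    and u: "u \<in> C" and w: "w \<in> D" and "E u (g w)" "E w (f u)"
  shows "\<exists>h. spanning_cycle E (C \<union> D) h"
proof -
  define h where "h = (\<lambda>x. if x \<in> C then f x else g x)"
  have hC: "h x = f x" if "x \<in> C" for x using that by (simp add: h_def)
  have hD: "h x = g x" if "x \<in> D" for x using that disj by (auto simp: h_def)
  have "bij_betw h C C" using f hC by (metis bij_betw_cong spanning_cycle_def cycle_factor_def)
  moreover have "bij_betw h D D" using g hD by (metis bij_betw_cong spanning_cycle_def cycle_factor_def)
  ultimately have bij: "bij_betw h (C \<union> D) (C \<union> D)" using disj by (rule bij_betw_combine)
  have fac: "cycle_factor E (C \<union> D) h"
    using bij f g hC hD by (auto simp: spanning_cycle_def cycle_factor_def)
  have Cc: "C \<in> closed_sets h (C \<union> D)" using \<open>bij_betw h C C\<close> by (auto simp: closed_sets_def bij_betw_def)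
  let ?h = "h(u := h w, w := h u)"
  have wD: "w \<in> C \<union> D - C" using w disj by blast
  have wC: "w \<notin> C" using w disj by blast
  have fac': "cycle_factor E (C \<union> D) ?h"
    by (rule swap_factor[OF fac]) (use assms wC in \<open>auto simp: h_def\<close>)
  have "S \<in> {{}, C \<union> D}" if S: "S \<in> closed_sets ?h (C \<union> D)" for S
  proof -
    have *: "S \<in> closed_sets h (C \<union> D)" if "S \<in> closed_sets ?h (C \<union> D)" for S
      using swap_closed_sets[OF bij _ Cc u wD] that fin by blast
    have SC: "S \<noteq> C" if "S \<in> closed_sets ?h (C \<union> D)" for S
      using swap_closed_sets[OF bij _ Cc u wD] that fin by blast
    have "S \<inter> C \<in> closed_sets f C" using *[OF S] hC f
      by (auto simp: closed_sets_def spanning_cycle_def cycle_factor_def bij_betw_def)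
    then have 1: "S \<inter> C = {} \<or> S \<inter> C = C" using f by (auto simp: spanning_cycle_def)
    have "S \<inter> D \<in> closed_sets g D" using *[OF S] hD g
      by (auto simp: closed_sets_def spanning_cycle_def cycle_factor_def bij_betw_def)
    then have 2: "S \<inter> D = {} \<or> S \<inter> D = D" using g by (auto simp: spanning_cycle_def)
    have SV: "S \<subseteq> C \<union> D" using S by (auto simp: closed_sets_def)
    have "C \<union> D - S \<in> closed_sets ?h (C \<union> D)"
      using closed_sets_Diff[of ?h "C \<union> D" S] fac' S fin by (auto simp: cycle_factor_def)
    then have "C \<union> D - S \<noteq> C" "S \<noteq> C" using SC S by blast+
    then show ?thesis using 1 2 SV disj by blast
  qed
  then show ?thesis using fac' by (auto simp: spanning_cycle_def)
qed

section \<open>One-orbit permutations and cyclic vertex sequences\<close>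

lemma
  assumes f: "spanning_cycle E V f" and fin: "finite V" and z: "z \<in> V"
  shows spanning_cycle_inj_on: "inj_on (\<lambda>i. (f ^^ i) z) {..<card V}"
    and spanning_cycle_period: "(f ^^ card V) z = z"
    and spanning_cycle_range: "(\<lambda>i. (f ^^ i) z) ` {..<card V} = V"
proof -
  have bij: "bij_betw f V V" using f by (auto simp: spanning_cycle_def cycle_factor_def)
  have bijn: "bij_betw (f ^^ n) V V" for n using bij by (rule bij_betw_funpow)
  have mem: "(f ^^ i) z \<in> V" for i using bijn[of i] z by (auto simp: bij_betw_def)
  have cancel: "(f ^^ (j - i)) z = z" if "i < j" "(f ^^ i) z = (f ^^ j) z" for i j
  proof -
    have "(f ^^ j) z = (f ^^ i) ((f ^^ (j - i)) z)"
      using \<open>i < j\<close> by (metis comp_apply funpow_add le_add_diff_inverse less_imp_le_nat)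
    then show ?thesis using that bijn[of i] z mem by (metis bij_betw_def inj_onD)
  qed
  have "\<not> inj_on (\<lambda>i. (f ^^ i) z) {..card V}"
  proof
    assume "inj_on (\<lambda>i. (f ^^ i) z) {..card V}"
    then have "card {..card V} \<le> card V" by (rule card_inj_on_le) (use mem fin in auto)
    then show False by simp
  qed
  then obtain i j where "i < j" "(f ^^ i) z = (f ^^ j) z"
    by (auto simp: inj_on_def) (metis nat_neq_iff)
  then have ex: "\<exists>n. 0 < n \<and> (f ^^ n) z = z" using cancel by (meson zero_less_diff)
  define n where "n = (LEAST n. 0 < n \<and> (f ^^ n) z = z)"
  have n: "0 < n" "(f ^^ n) z = z" using LeastI_ex[OF ex] by (auto simp: n_def)
  have inj: "inj_on (\<lambda>i. (f ^^ i) z) {..<n}"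
  proof -
    have False if "i < j" "j < n" "(f ^^ i) z = (f ^^ j) z" for i j
      using cancel[OF that(1,3)] Least_le[of "\<lambda>n. 0 < n \<and> (f ^^ n) z = z" "j - i"] that
      by (simp add: n_def[symmetric])
    then show ?thesis unfolding inj_on_def by (metis lessThan_iff nat_neq_iff)
  qed
  let ?O = "(\<lambda>i. (f ^^ i) z) ` {..<n}"
  have "f x \<in> ?O" if "x \<in> ?O" for x
  proof -
    obtain i where i: "i < n" "x = (f ^^ i) z" using \<open>x \<in> ?O\<close> by blast
    show ?thesis
    proof (cases "Suc i < n")
      case True
      then show ?thesis using i by (intro image_eqI[of _ _ "Suc i"]) auto
    next
      case False
      then have "Suc i = n" using i by simp
      then have "f x = (f ^^ 0) z" using i n(2) by auto
      then show ?thesis using n(1) by (intro image_eqI[of _ _ 0]) auto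
    qed
  qed
  \<comment> \<open>The orbit of \<open>z\<close> over its least period is closed and nonempty,
    hence all of \<open>V\<close>; so the least period is \<open>card V\<close>.\<close>
  then have "?O \<in> closed_sets f V" using mem by (auto simp: closed_sets_def)
  moreover have "?O \<noteq> {}" using n by auto
  ultimately have O: "?O = V" using f unfolding spanning_cycle_def by blast
  moreover have "card ?O = n" using inj by (simp add: card_image)
  ultimately have "card V = n" by simp
  then show "inj_on (\<lambda>i. (f ^^ i) z) {..<card V}" "(f ^^ card V) z = z"
    "(\<lambda>i. (f ^^ i) z) ` {..<card V} = V" using inj n O by auto
qed

text \<open>Cycles that are written down vertex by vertex enter the permutation encoding
  here.\<close>

lemma spanning_cycle_of_seq:
  assumes "0 < n" and inj: "inj_on r {..<n}" and E: "\<And>i. Suc i < n \<Longrightarrow> E (r i) (r (Suc i))"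
    and last: "E (r (n - 1)) (r 0)"
  shows "\<exists>f. spanning_cycle E (r ` {..<n}) f"
proof -
  define f where "f = (\<lambda>x. r (Suc (inv_into {..<n} r x) mod n))"
  have f: "f (r i) = r (Suc i mod n)" if "i < n" for i using that inj by (simp add: f_def)
  let ?V = "r ` {..<n}"
  have "f ` ?V = ?V"
  proof
    show "f ` ?V \<subseteq> ?V" using f \<open>0 < n\<close> by auto
    show "?V \<subseteq> f ` ?V"
    proof (clarsimp)
      fix i assume "i < n"
      show "r i \<in> f ` ?V"
      proof (cases i)
        case 0
        then have "r i = f (r (n - 1))" using f[of "n - 1"] \<open>0 < n\<close> by simp
        then show ?thesis using \<open>0 < n\<close> by auto
      next
        case (Suc j)
        then have "r i = f (r j)" using f[of j] \<open>i < n\<close> by simp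
        then show ?thesis using Suc \<open>i < n\<close> by auto
      qed
    qed
  qed
  then have bij: "bij_betw f ?V ?V" by (simp add: bij_betw_def eq_card_imp_inj_on)
  have "E (r i) (f (r i))" if "i < n" for i
  proof (cases "Suc i < n")
    case True
    then show ?thesis using f[OF that] E by simp
  next
    case False
    then have "i = n - 1" using that by simp
    then show ?thesis using f[OF that] last \<open>0 < n\<close> by simp
  qed
  then have fac: "cycle_factor E ?V f" using bij by (auto simp: cycle_factor_def)
  have "S = {} \<or> S = ?V" if S: "S \<in> closed_sets f ?V" for S
  proof (cases "S = {}")
    case False
    then obtain i where i: "i < n" "r i \<in> S" using S by (auto simp: closed_sets_def)
    have fS: "f x \<in> S" if "x \<in> S" for x using S that by (auto simp: closed_sets_def)
    have step: "r ((i + j) mod n) \<in> S" for j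
    proof (induction j)
      case (Suc j)
      have "f (r ((i + j) mod n)) = r (Suc ((i + j) mod n) mod n)" using f \<open>0 < n\<close> by simp
      then show ?case using fS[OF Suc] by (simp add: mod_Suc_eq)
    qed (use i in auto)
    \<comment> \<open>From index \<open>i\<close>, going \<open>n - i\<close> steps wraps around to
      0 and \<open>j\<close> more steps reach \<open>j\<close>.\<close>
    have "r j \<in> S" if "j < n" for j
      using step[of "n - i + j"] that i(1) by simp
    then show ?thesis using S by (auto simp: closed_sets_def)
  qed auto
  then show ?thesis using fac by (auto simp: spanning_cycle_def)
qed

section \<open>Counting arcs under the degree condition\<close>

definition deg :: "('a \<Rightarrow> 'a \<Rightarrow> bool) \<Rightarrow> 'a \<Rightarrow> nat" where
  "deg E v = card {w. E v w} + card {w. E w v}"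

definition arcs_between :: "('a \<Rightarrow> 'a \<Rightarrow> bool) \<Rightarrow> 'a set \<Rightarrow> 'a set \<Rightarrow> int" where
  "arcs_between E A B = (\<Sum>u\<in>A. \<Sum>v\<in>B. of_bool (E u v))"

lemma arcs_between_Un_right:
  assumes "finite B" "finite C" "B \<inter> C = {}"
  shows "arcs_between E A (B \<union> C) = arcs_between E A B + arcs_between E A C"
  unfolding arcs_between_def by (simp only: sum.union_disjoint[OF assms] sum.distrib)

lemma arcs_between_Un_left:
  assumes "finite A" "finite B" "A \<inter> B = {}"
  shows "arcs_between E (A \<union> B) C = arcs_between E A C + arcs_between E B C"
  unfolding arcs_between_def by (simp only: sum.union_disjoint[OF assms])

lemma arcs_between_le: "arcs_between E A B \<le> int (card A) * int (card B)"
proof -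
  have "arcs_between E A B \<le> (\<Sum>u\<in>A. \<Sum>v\<in>B. 1)"
    unfolding arcs_between_def by (intro sum_mono) auto
  then show ?thesis by simp
qed

lemma arcs_between_full:
  assumes "finite A" "finite B" "arcs_between E A B \<ge> int (card A) * int (card B)" "u \<in> A" "v \<in> B"
  shows "E u v"
proof (rule ccontr)
  assume "\<not> E u v"
  have "arcs_between E A B = (\<Sum>(u,v)\<in>A \<times> B. of_bool (E u v))"
    unfolding arcs_between_def by (simp add: sum.cartesian_product)
  also have "\<dots> < (\<Sum>(u,v)\<in>A \<times> B. 1)"
    by (rule sum_strict_mono_ex1) (use assms \<open>\<not> E u v\<close> in auto)
  finally show False using assms by (simp add: card_cartesian_product split_def)
qed

lemma arcs_between_empty_left [simp]: "arcs_between E {} B = 0"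
  and arcs_between_empty_right [simp]: "arcs_between E A {} = 0"
  by (simp_all add: arcs_between_def)

text \<open>The hypothesis of the theorem, once it is known that every vertex lies in a dominated pair.\<close>
locale dominated_bipartite =
  fixes E :: "'a \<Rightarrow> 'a \<Rightarrow> bool" and X Y :: "'a set" and a k :: nat
  assumes finX: "finite X" and finY: "finite Y" and disj: "X \<inter> Y = {}"
    and cardX: "card X = a" and cardY: "card Y = a"
    and bip: "\<And>u v. E u v \<Longrightarrow> u \<in> X \<and> v \<in> Y \<or> u \<in> Y \<and> v \<in> X"
    and strong: "\<And>S. S \<subseteq> X \<union> Y \<Longrightarrow> S \<noteq> {} \<Longrightarrow> S \<noteq> X \<union> Y \<Longrightarrow> \<exists>u\<in>S. \<exists>v\<in>X \<union> Y - S. E u v"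
    and deg_ge: "\<And>v. v \<in> X \<union> Y \<Longrightarrow> a + k \<le> deg E v"
    and dominated: "\<And>u v w. E w u \<Longrightarrow> E w v \<Longrightarrow> u \<noteq> v \<Longrightarrow> 2 * a - k \<le> deg E u \<or> 2 * a - k \<le> deg E v"
    and k_ge: "2 \<le> k" and k_le: "2 * k \<le> a"
begin

text \<open>The symmetry between the parts: each count is done for \<open>X\<close> only and reused
  for \<open>Y\<close>.\<close>

lemma swap: "dominated_bipartite E Y X a k"
  using finX finY disj cardX cardY bip strong deg_ge dominated k_ge k_le
  by unfold_locales (auto simp: Un_commute)

abbreviation "V \<equiv> X \<union> Y"
abbreviation "e \<equiv> arcs_between E"

definition low :: "'a set" where "low = {v \<in> V. deg E v < 2 * a - k}"

lemma finV: "finite V" using finX finY by simp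

lemma nbh_X:
  assumes "v \<in> X"
  shows "{w. E v w} \<subseteq> Y" "{w. E w v} \<subseteq> Y"
  using bip assms disj by blast+

lemma deg_X:
  assumes "v \<in> X"
  shows "int (deg E v) = (\<Sum>w\<in>Y. of_bool (E v w)) + (\<Sum>w\<in>Y. of_bool (E w v))"
proof -
  have "{w. E v w} = {w \<in> Y. E v w}" "{w. E w v} = {w \<in> Y. E w v}" using nbh_X[OF assms] by auto
  then show ?thesis using finY by (simp add: deg_def sum_of_bool_eq Int_def)
qed

lemma sum_deg_X:
  assumes "A \<subseteq> X"
  shows "(\<Sum>v\<in>A. int (deg E v)) = e A Y + e Y A"
proof -
  have "(\<Sum>v\<in>A. int (deg E v)) = (\<Sum>v\<in>A. (\<Sum>w\<in>Y. of_bool (E v w)) + (\<Sum>w\<in>Y. of_bool (E w v)))"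
    by (rule sum.cong) (use deg_X assms in auto)
  also have "\<dots> = e A Y + e Y A"
    unfolding arcs_between_def by (simp add: sum.distrib sum.swap[of _ A Y])
  finally show ?thesis .
qed

text \<open>This is Hall's condition in symmetric form. If it failed, the vertices of
  \<open>S\<close> would lose so many out-neighbours that all of them are low. Their
  in-neighbourhoods are then disjoint, while each needs \<open>card T + k\<close> elements for
  degree \<open>a + k\<close>, more than \<open>Y\<close> can hold.\<close>

lemma no_arcs_card:
  assumes S: "S \<subseteq> X" and T: "T \<subseteq> Y" and no: "\<And>s t. s \<in> S \<Longrightarrow> t \<in> T \<Longrightarrow> \<not> E s t"
  shows "card S + card T \<le> a"
proof (rule ccontr)
  assume neg: "\<not> ?thesis"
  interpret sw: dominated_bipartite E Y X a k by (rule swap)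
  have fin: "finite S" "finite T" using S T finX finY finite_subset by blast+
  have cS: "card S \<le> a" "card T \<le> a" using S T finX finY cardX cardY card_mono by metis+
  have out: "card {w. E s w} \<le> a - card T" if "s \<in> S" for s
  proof -
    have "{w. E s w} \<subseteq> Y - T" using nbh_X[of s] no that S by blast
    then have "card {w. E s w} \<le> card (Y - T)" using finY by (simp add: card_mono)
    then show ?thesis using T fin cardY by (simp add: card_Diff_subset)
  qed
  have inT: "card {w. E w t} \<le> a - card S" if "t \<in> T" for t
  proof -
    have "{w. E w t} \<subseteq> X - S" using sw.nbh_X[of t] no that T by blast
    then have "card {w. E w t} \<le> card (X - S)" using finX by (simp add: card_mono)
    then show ?thesis using S fin cardX by (simp add: card_Diff_subset)
  qed
  have inS: "card {w. E w s} \<le> a" if "s \<in> S" for s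
    using nbh_X[of s] that S finY cardY by (metis card_mono subsetD)
  have outT: "card {w. E t w} \<le> a" if "t \<in> T" for t
    using sw.nbh_X[of t] that T finX cardX by (metis card_mono subsetD)
  have pos: "1 \<le> card S" "1 \<le> card T" using neg cS by linarith+
  then obtain t where t: "t \<in> T" by fastforce
  \<comment> \<open>A vertex of \<open>T\<close> has at most \<open>a - card S\<close>
    in-neighbours, so its degree of at least \<open>a + k\<close> bounds \<open>card S\<close>; this
    bound is what makes the vertices of \<open>S\<close> low.\<close>
  then have "card S + k \<le> a" using deg_ge[of t] inT[OF t] outT[OF t] T cS unfolding deg_def by auto
  then have lowS: "s \<in> low" if "s \<in> S" for s
  proof -
    have "deg E s < 2 * a - k"
      unfolding deg_def using out[OF that] inS[OF that] neg cS k_le k_ge \<open>card S + k \<le> a\<close> by linarith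
    then show ?thesis using that S by (auto simp: low_def)
  qed
  have big: "card T + k \<le> card {w. E w s}" if "s \<in> S" for s
    using deg_ge[of s] out[OF that] that S cS by (auto simp: deg_def)
  have "card S * (card T + k) = (\<Sum>s\<in>S. card T + k)" by simp
  also have "\<dots> \<le> (\<Sum>s\<in>S. card {w. E w s})" by (rule sum_mono) (rule big)
  also have "\<dots> = card (\<Union>s\<in>S. {w. E w s})"
  proof (rule card_UN_disjoint[symmetric])
    show "finite S" by fact
    show "\<forall>s\<in>S. finite {w. E w s}" using nbh_X S finY by (meson finite_subset subsetD)
    show "\<forall>s\<in>S. \<forall>s'\<in>S. s \<noteq> s' \<longrightarrow> {w. E w s} \<inter> {w. E w s'} = {}"
      using lowS dominated by (auto simp: low_def) (meson linorder_not_less)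
  qed
  also have "\<dots> \<le> card Y" by (rule card_mono) (use finY nbh_X S in blast)+
  finally have *: "card S * (card T + k) \<le> a" using cardY by simp
  obtain s' t' where st: "card S = Suc s'" "card T = Suc t'" using pos by (metis One_nat_def Suc_le_D)
  \<comment> \<open>For positive cardinalities
    \<open>card S * card T \<ge> card S + card T - 1 \<ge> a\<close>, so the positive summand
    \<open>card S * k\<close> is too much.\<close>
  have "card S * card T + card S * k \<le> a" using * by (simp add: distrib_left)
  moreover have "card S * card T \<ge> card S + card T - 1" using st by simp
  moreover have "card S * k > 0" using pos k_ge by simp
  ultimately show False using neg by linarith
qed

lemma matching_X: "\<exists>f. inj_on f X \<and> (\<forall>x\<in>X. E x (f x))"
proof -
  have "card T \<le> card (\<Union>((\<lambda>x. {y. E x y}) ` T))" if "T \<subseteq> X" for T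
  proof -
    let ?N = "\<Union>((\<lambda>x. {y. E x y}) ` T)"
    have N: "?N \<subseteq> Y" using nbh_X that by blast
    have "card T + card (Y - ?N) \<le> a" by (rule no_arcs_card) (use that in auto)
    moreover have "card (Y - ?N) = a - card ?N" "card ?N \<le> a"
      using N finY cardY by (metis card_Diff_subset finite_subset) (use N finY cardY card_mono in blast)
    ultimately show ?thesis by linarith
  qed
  then have "\<exists>f. inj_on f X \<and> (\<forall>x\<in>X. f x \<in> {y. E x y})"
    by (intro hall_marriage finX) (use nbh_X finY in \<open>meson finite_subset\<close>)
  then show ?thesis by simp
qed

text \<open>A perfect matching from \<open>X\<close> to \<open>Y\<close> and one from
  \<open>Y\<close> to \<open>X\<close> together form a permutation along arcs.\<close>

lemma ex_cycle_factor: "\<exists>f. cycle_factor E V f"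
proof -
  interpret sw: dominated_bipartite E Y X a k by (rule swap)
  obtain f where f: "inj_on f X" "\<forall>x\<in>X. E x (f x)" using matching_X by blast
  obtain g where g: "inj_on g Y" "\<forall>x\<in>Y. E x (g x)" using sw.matching_X by blast
  have fX: "f ` X = Y"
    by (rule card_subset_eq[OF finY]) (use f nbh_X cardX cardY in \<open>auto simp: card_image\<close>)
  have gY: "g ` Y = X"
    by (rule card_subset_eq[OF finX]) (use g sw.nbh_X cardX cardY in \<open>auto simp: card_image\<close>)
  define h where "h = (\<lambda>v. if v \<in> X then f v else g v)"
  have "bij_betw h X Y" using f fX by (simp add: bij_betw_def h_def cong: inj_on_cong)
  moreover have "\<And>v. v \<in> Y \<Longrightarrow> h v = g v" using disj by (auto simp: h_def)
  then have "bij_betw h Y X" using g gY by (simp add: bij_betw_def cong: inj_on_cong image_cong)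
  ultimately have "bij_betw h V (Y \<union> X)" using disj by (intro bij_betw_combine) auto
  then show ?thesis using f g by (auto simp: cycle_factor_def h_def Un_commute)
qed

section \<open>Arcs between two disjoint unions of cycles\<close>

lemma factor_bij_betw:
  assumes "cycle_factor E C f" "C \<subseteq> V"
  shows "bij_betw f (C \<inter> X) (C \<inter> Y)"
proof -
  have inj: "inj_on f C" and im: "f ` C = C" and E: "\<And>v. v \<in> C \<Longrightarrow> E v (f v)"
    using assms by (auto simp: cycle_factor_def bij_betw_def)
  have "f ` (C \<inter> X) = C \<inter> Y"
  proof
    show "f ` (C \<inter> X) \<subseteq> C \<inter> Y" using im E bip disj by blast
    show "C \<inter> Y \<subseteq> f ` (C \<inter> X)"
    proof
      fix y assume y: "y \<in> C \<inter> Y"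
      then obtain x where "x \<in> C" "y = f x" using im by blast
      then show "y \<in> f ` (C \<inter> X)" using E[of x] bip[of x y] y disj by blast
    qed
  qed
  then show ?thesis using inj by (auto simp: bij_betw_def intro: inj_on_subset)
qed

lemma factor_card_eq:
  assumes "cycle_factor E C f" "C \<subseteq> V"
  shows "card (C \<inter> Y) = card (C \<inter> X)"
  using factor_bij_betw[OF assms] by (metis bij_betw_same_card)

text \<open>Since \<open>f\<close> and \<open>g\<close> biject the \<open>X\<close> sides with the
  \<open>Y\<close> sides, the crossing arcs from \<open>X\<close> to \<open>Y\<close> are indexed by
  pairs \<open>u\<close>, \<open>w\<close> in \<open>X\<close>, and each pair holds just the two
  arcs that an exchange at \<open>u\<close> and \<open>w\<close> needs. Allowing \<open>f\<close>
  and \<open>g\<close> to differ serves both for two parts of one factor and for two separate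
  cycles.\<close>

lemma cross_arcs_eq:
  assumes "cycle_factor E C f" "C \<subseteq> V" "cycle_factor E D g" "D \<subseteq> V"
  shows "e (C \<inter> X) (D \<inter> Y) + e (D \<inter> X) (C \<inter> Y)
    = (\<Sum>u\<in>C \<inter> X. \<Sum>w\<in>D \<inter> X. of_bool (E u (g w)) + of_bool (E w (f u)))"
proof -
  have 1: "(\<Sum>y\<in>D \<inter> Y. of_bool (E u y)) = (\<Sum>w\<in>D \<inter> X. (of_bool (E u (g w)) :: int))" for u
    using sum.reindex_bij_betw[OF factor_bij_betw[OF assms(3,4)], of "\<lambda>y. of_bool (E u y) :: int"] by simp
  have 2: "(\<Sum>y\<in>C \<inter> Y. of_bool (E w y)) = (\<Sum>u\<in>C \<inter> X. (of_bool (E w (f u)) :: int))" for w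
    using sum.reindex_bij_betw[OF factor_bij_betw[OF assms(1,2)], of "\<lambda>y. of_bool (E w y) :: int"] by simp
  show ?thesis unfolding arcs_between_def 1 2
    by (simp add: sum.distrib sum.swap[of _ "D \<inter> X" "C \<inter> X"])
qed

lemma cross_arcs_le:
  assumes "cycle_factor E C f" "C \<subseteq> V" "cycle_factor E D g" "D \<subseteq> V"
    and no: "\<And>u w. u \<in> C \<Longrightarrow> w \<in> D \<Longrightarrow> \<not> (E u (g w) \<and> E w (f u))"
  shows "e (C \<inter> X) (D \<inter> Y) + e (D \<inter> X) (C \<inter> Y) \<le> int (card (C \<inter> X)) * int (card (D \<inter> X))"
proof -
  have "(\<Sum>u\<in>C \<inter> X. \<Sum>w\<in>D \<inter> X. of_bool (E u (g w)) + of_bool (E w (f u)) :: int)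
      \<le> (\<Sum>u\<in>C \<inter> X. \<Sum>w\<in>D \<inter> X. 1)"
    by (intro sum_mono) (use no in force)
  then show ?thesis unfolding cross_arcs_eq[OF assms(1-4)] by simp
qed

text \<open>Each vertex has at most one low out-neighbour and so misses all but one of the low
  vertices in \<open>B\<close>; \<open>max 0\<close> covers a \<open>B\<close> without low
  vertices.\<close>

lemma arcs_low_le:
  assumes "finite B" "finite A" "B \<subseteq> V"
  shows "e A B \<le> int (card A) * (int (card B) - max 0 (int (card (B \<inter> low)) - 1))"
proof -
  have "(\<Sum>v\<in>B. of_bool (E u v)) \<le> int (card B) - max 0 (int (card (B \<inter> low)) - 1)" for u
  proof -
    let ?O = "{v \<in> B \<inter> low. E u v}"
    have "card ?O \<le> 1"
    proof -
      have "x = y" if "x \<in> ?O" "y \<in> ?O" for x y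
        using that dominated[of u x y] by (force simp: low_def)
      then show ?thesis using assms(1) by (simp add: card_le_Suc0_iff_eq)
    qed
    moreover have "{v \<in> B. E u v} \<subseteq> (B - low) \<union> ?O" by blast
    then have "card {v \<in> B. E u v} \<le> card ((B - low) \<union> ?O)" using assms(1) by (intro card_mono) auto
    moreover have "card ((B - low) \<union> ?O) \<le> card (B - low) + card ?O" by (rule card_Un_le)
    moreover have "card (B - low) + card (B \<inter> low) = card B"
      using assms(1) by (metis card_Int_Diff add.commute)
    moreover have "card {v \<in> B. E u v} \<le> card B" using assms(1) by (intro card_mono) auto
    ultimately have "int (card {v \<in> B. E u v}) \<le> int (card B) - max 0 (int (card (B \<inter> low)) - 1)"
      by linarith
    then show ?thesis using assms(1) by (simp add: sum_of_bool_eq Int_def)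
  qed
  then have "e A B \<le> (\<Sum>u\<in>A. int (card B) - max 0 (int (card (B \<inter> low)) - 1))"
    unfolding arcs_between_def by (intro sum_mono)
  then show ?thesis by simp
qed

text \<open>Every vertex is credited with \<open>2 * a - k\<close>; a low one falls short by at most
  \<open>a - 2 * k\<close>, the distance down to \<open>a + k\<close>.\<close>

lemma sum_deg_ge:
  assumes "B \<subseteq> V"
  shows "int (card B) * (2 * int a - int k) - int (card (B \<inter> low)) * (int a - 2 * int k)
    \<le> (\<Sum>v\<in>B. int (deg E v))"
proof -
  have fin: "finite B" using assms finV finite_subset by blast
  have "int (card B) * (2 * int a - int k) - int (card (B \<inter> low)) * (int a - 2 * int k)
    = (\<Sum>v\<in>B. 2 * int a - int k - of_bool (v \<in> low) * (int a - 2 * int k))"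
    using fin by (simp add: sum_subtractf sum_distrib_right[symmetric] sum_of_bool_eq Int_def)
  also have "\<dots> \<le> (\<Sum>v\<in>B. int (deg E v))"
  proof (rule sum_mono)
    fix v assume "v \<in> B"
    then have "a + k \<le> deg E v" "v \<notin> low \<longrightarrow> 2 * a - k \<le> deg E v"
      using assms deg_ge by (auto simp: low_def)
    then show "2 * int a - int k - of_bool (v \<in> low) * (int a - 2 * int k) \<le> int (deg E v)"
      using k_le by auto
  qed
  finally show ?thesis .
qed

text \<open>The third set \<open>Y - C - D\<close> holds the vertices covered by neither side: none
  when \<open>C\<close> and \<open>D\<close> split a cycle factor, one when a cycle of length
  \<open>2 * a - 2\<close> is sought.\<close>

lemma sum_deg_split_X:
  assumes "C \<subseteq> V" "D \<subseteq> V" "C \<inter> D = {}" "A \<subseteq> X"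
  shows "(\<Sum>v\<in>A. int (deg E v)) = e A (C \<inter> Y) + e A (D \<inter> Y) + e A (Y - C - D)
    + e (C \<inter> Y) A + e (D \<inter> Y) A + e (Y - C - D) A"
proof -
  have Y: "Y = (C \<inter> Y \<union> D \<inter> Y) \<union> (Y - C - D)" by blast
  have "finite A" using assms(4) finX finite_subset by blast
  have "e A Y = e A (C \<inter> Y) + e A (D \<inter> Y) + e A (Y - C - D)"
    by (subst Y, subst arcs_between_Un_right, auto simp: finY, subst arcs_between_Un_right)
      (use finY assms(3) in auto)
  moreover have "e Y A = e (C \<inter> Y) A + e (D \<inter> Y) A + e (Y - C - D) A"
    by (subst Y, subst arcs_between_Un_left, auto simp: finY, subst arcs_between_Un_left)
      (use finY assms(3) in auto)
  ultimately show ?thesis using sum_deg_X[OF assms(4)] by simp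
qed

end

section \<open>Hamiltonicity\<close>

text \<open>The left-hand side is affine in \<open>l\<close> on \<open>{1..p}\<close>; the two last hypotheses say that it is
  positive at the end points.\<close>
lemma gap_pos:
  fixes p m k l r :: int
  assumes "1 \<le> p" "1 \<le> m" "0 \<le> l" "l \<le> p"
    and one: "0 < (p - 1) * (m - 1) + k - 1 - r" and top: "0 < p * (p + k - 2) - r"
  shows "0 < p * m + (2 * p + r) * max 0 (l - 1) - l * (m + p + r - k)"
proof (cases "l = 0")
  case True
  then show ?thesis using assms by simp
next
  case False
  let ?e = "m + p + r - k"
  have l: "max 0 (l - 1) = l - 1" using False assms by simp
  show ?thesis
  proof (cases "?e \<le> 2 * p + r")
    case True
    then have "0 \<le> (l - 1) * (2 * p + r - ?e)" using False assms by (intro mult_nonneg_nonneg) auto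
    moreover have "p * m + (2 * p + r) * (l - 1) - l * ?e
      = ((p - 1) * (m - 1) + k - 1 - r) + (l - 1) * (2 * p + r - ?e)" by (simp add: algebra_simps)
    ultimately show ?thesis using one l by simp
  next
    case c: False
    then have "0 \<le> (p - l) * (?e - (2 * p + r))" using assms by (intro mult_nonneg_nonneg) auto
    moreover have "p * m + (2 * p + r) * (l - 1) - l * ?e
      = (p * (p + k - 2) - r) + (p - l) * (?e - (2 * p + r))" by (simp add: algebra_simps)
    ultimately show ?thesis using top l by simp
  qed
qed

context dominated_bipartite
begin

lemma sum_deg_split:
  assumes "C \<subseteq> V" "D \<subseteq> V" "C \<inter> D = {}"
  shows "(\<Sum>v\<in>C \<inter> X. int (deg E v)) = e (C \<inter> X) (C \<inter> Y) + e (C \<inter> Y) (C \<inter> X)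
      + e (C \<inter> X) (D \<inter> Y) + e (D \<inter> Y) (C \<inter> X) + e (C \<inter> X) (Y - C - D) + e (Y - C - D) (C \<inter> X)"
    and "(\<Sum>v\<in>C \<inter> Y. int (deg E v)) = e (C \<inter> X) (C \<inter> Y) + e (C \<inter> Y) (C \<inter> X)
      + e (D \<inter> X) (C \<inter> Y) + e (C \<inter> Y) (D \<inter> X) + e (C \<inter> Y) (X - C - D) + e (X - C - D) (C \<inter> Y)"
proof -
  interpret sw: dominated_bipartite E Y X a k by (rule swap)
  show "(\<Sum>v\<in>C \<inter> X. int (deg E v)) = e (C \<inter> X) (C \<inter> Y) + e (C \<inter> Y) (C \<inter> X)
      + e (C \<inter> X) (D \<inter> Y) + e (D \<inter> Y) (C \<inter> X) + e (C \<inter> X) (Y - C - D) + e (Y - C - D) (C \<inter> X)"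
    using sum_deg_split_X[OF assms, of "C \<inter> X"] by simp
  show "(\<Sum>v\<in>C \<inter> Y. int (deg E v)) = e (C \<inter> X) (C \<inter> Y) + e (C \<inter> Y) (C \<inter> X)
      + e (D \<inter> X) (C \<inter> Y) + e (C \<inter> Y) (D \<inter> X) + e (C \<inter> Y) (X - C - D) + e (X - C - D) (C \<inter> Y)"
    using sw.sum_deg_split_X[of C D "C \<inter> Y"] assms by (simp add: Un_commute)
qed

lemma card_part:
  assumes "C \<subseteq> V" "D \<subseteq> V" "C \<inter> D = {}"
  shows "card (C \<inter> X) + card (D \<inter> X) + card (X - C - D) = a"
proof -
  have "X = (C \<inter> X \<union> D \<inter> X) \<union> (X - C - D)" by blast
  then have "card X = card ((C \<inter> X \<union> D \<inter> X) \<union> (X - C - D))" by simp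
  also have "\<dots> = card (C \<inter> X \<union> D \<inter> X) + card (X - C - D)"
    by (rule card_Un_disjoint) (use finX in auto)
  also have "card (C \<inter> X \<union> D \<inter> X) = card (C \<inter> X) + card (D \<inter> X)"
    by (rule card_Un_disjoint) (use finX assms in auto)
  finally show ?thesis using cardX by simp
qed

text \<open>The degree sums over both sides of \<open>C\<close> are bounded below through
  \<open>low\<close> and above by counting arcs. Arcs between \<open>C\<close> and \<open>D\<close>
  count half by the pairing; arcs into \<open>C\<close> from \<open>C\<close> itself and from the
  missed vertices are reduced by \<open>arcs_low_le\<close>. Each side of \<open>C\<close> then
  yields the expression of \<open>gap_pos\<close>, where \<open>m\<close> is the excess, per vertex,
  of required over available degree before low vertices are taken into account.\<close>

lemma no_merge_ineq:
  assumes C: "cycle_factor E C f" "C \<subseteq> V" and D: "cycle_factor E D g" "D \<subseteq> V" and CD: "C \<inter> D = {}"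
    and no: "\<And>u w. u \<in> C \<Longrightarrow> w \<in> D \<Longrightarrow> \<not> (E u (g w) \<and> E w (f u))"
    and p: "p = int (card (C \<inter> X))" and r: "r = int (card (X - C - D))" and m: "m = int a - int k - p - r"
    and lX: "lX = int (card (C \<inter> X \<inter> low))" and lY: "lY = int (card (C \<inter> Y \<inter> low))"
  shows "(p * m + (2 * p + r) * max 0 (lX - 1) - lX * (m + p + r - int k))
    + (p * m + (2 * p + r) * max 0 (lY - 1) - lY * (m + p + r - int k)) \<le> 0"
proof -
  interpret sw: dominated_bipartite E Y X a k by (rule swap)
  have swlow: "sw.low = low" by (auto simp: low_def sw.low_def)
  define q where "q = int (card (D \<inter> X))"
  have pY: "int (card (C \<inter> Y)) = p" and qY: "int (card (D \<inter> Y)) = q"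
    using factor_card_eq[OF C] factor_card_eq[OF D] p by (auto simp: q_def)
  have part: "p + q + r = int a" using card_part[OF C(2) D(2) CD] p r by (simp add: q_def)
  have rY: "int (card (Y - C - D)) = r"
    using sw.card_part[of C D] C D CD pY qY part by (simp add: Un_commute)
  have cr1: "e (C \<inter> X) (D \<inter> Y) + e (D \<inter> X) (C \<inter> Y) \<le> p * q"
    using cross_arcs_le[OF C D no] p by (simp add: q_def)
  have cr2: "e (C \<inter> Y) (D \<inter> X) + e (D \<inter> Y) (C \<inter> X) \<le> p * q"
    using sw.cross_arcs_le[OF C(1) _ D(1) _ no] C D pY qY by (simp add: Un_commute)
  define MX where "MX = max 0 (lX - 1)"
  define MY where "MY = max 0 (lY - 1)"
  have sub: "C \<inter> X \<subseteq> V" "C \<inter> Y \<subseteq> V" by auto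
  have in1: "e (C \<inter> Y) (C \<inter> X) \<le> p * (p - MX)"
    using arcs_low_le[of "C \<inter> X" "C \<inter> Y"] finX finY sub p lX pY by (simp add: MX_def)
  have in2: "e (C \<inter> X) (C \<inter> Y) \<le> p * (p - MY)"
    using arcs_low_le[of "C \<inter> Y" "C \<inter> X"] finX finY sub p lY pY by (simp add: MY_def)
  have in3: "e (Y - C - D) (C \<inter> X) \<le> r * (p - MX)"
    using arcs_low_le[of "C \<inter> X" "Y - C - D"] finX finY sub p lX rY by (simp add: MX_def)
  have in4: "e (X - C - D) (C \<inter> Y) \<le> r * (p - MY)"
    using arcs_low_le[of "C \<inter> Y" "X - C - D"] finX finY sub r lY pY by (simp add: MY_def)
  have o1: "e (C \<inter> X) (Y - C - D) \<le> p * r" using arcs_between_le[of E "C \<inter> X" "Y - C - D"] p rY by simp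
  have o2: "e (C \<inter> Y) (X - C - D) \<le> p * r" using arcs_between_le[of E "C \<inter> Y" "X - C - D"] r pY by simp
  have low1: "p * (2 * int a - int k) - lX * (int a - 2 * int k) \<le> (\<Sum>v\<in>C \<inter> X. int (deg E v))"
    using sum_deg_ge[of "C \<inter> X"] p lX by auto
  have low2: "p * (2 * int a - int k) - lY * (int a - 2 * int k) \<le> (\<Sum>v\<in>C \<inter> Y. int (deg E v))"
    using sum_deg_ge[of "C \<inter> Y"] pY lY by auto
  have "2 * (p * (2 * int a - int k)) - lX * (int a - 2 * int k) - lY * (int a - 2 * int k)
    \<le> 2 * (p * q) + 2 * (p * (p - MX)) + 2 * (p * (p - MY)) + r * (p - MX) + r * (p - MY) + 2 * (p * r)"
    using low1 low2 cr1 cr2 in1 in2 in3 in4 o1 o2 sum_deg_split[OF C(2) D(2) CD] by linarith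
  moreover have q: "q = int a - p - r" using part by simp
  moreover have "int a = m + p + r + int k" using m by simp
  ultimately show ?thesis unfolding MX_def[symmetric] MY_def[symmetric] by (simp add: algebra_simps)
qed

text \<open>With \<open>a = 2 k\<close> the count of arcs leaves no slack for two cycles of equal length.\<close>
lemma no_merge_tight:
  assumes C: "cycle_factor E C f" "C \<subseteq> V" and D: "cycle_factor E (V - C) g"
    and no: "\<And>u w. u \<in> C \<Longrightarrow> w \<in> V - C \<Longrightarrow> \<not> (E u (g w) \<and> E w (f u))"
    and p: "card (C \<inter> X) = k" and a: "a = 2 * k"
  shows "\<And>x y. x \<in> C \<inter> X \<Longrightarrow> y \<in> C \<inter> Y \<Longrightarrow> E x y \<and> E y x"
    and "e (C \<inter> X) ((V - C) \<inter> Y) + e ((V - C) \<inter> X) (C \<inter> Y) = int k * int k"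
    and "e (C \<inter> Y) ((V - C) \<inter> X) + e ((V - C) \<inter> Y) (C \<inter> X) = int k * int k"
    and "e (C \<inter> X) ((V - C) \<inter> Y) + e ((V - C) \<inter> Y) (C \<inter> X) = int k * int k"
proof -
  interpret sw: dominated_bipartite E Y X a k by (rule swap)
  let ?D = "V - C"
  have DV: "?D \<subseteq> V" and CD: "C \<inter> ?D = {}" by auto
  have R: "X - C - ?D = {}" "Y - C - ?D = {}" by auto
  have q: "card (?D \<inter> X) = k" using card_part[OF C(2) DV CD] p a R by simp
  have pY: "card (C \<inter> Y) = k" "card (?D \<inter> Y) = k"
    using factor_card_eq[OF C] factor_card_eq[OF D DV] p q by auto
  let ?k = "int k * int k"
  have cr1: "e (C \<inter> X) (?D \<inter> Y) + e (?D \<inter> X) (C \<inter> Y) \<le> ?k"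
    using cross_arcs_le[OF C D DV no] p q by simp
  have cr2: "e (C \<inter> Y) (?D \<inter> X) + e (?D \<inter> Y) (C \<inter> X) \<le> ?k"
    using sw.cross_arcs_le[OF C(1) _ D _ no] C pY by (simp add: Un_commute)
  have i1: "e (C \<inter> Y) (C \<inter> X) \<le> ?k" using arcs_between_le[of E "C \<inter> Y" "C \<inter> X"] p pY by simp
  have i2: "e (C \<inter> X) (C \<inter> Y) \<le> ?k" using arcs_between_le[of E "C \<inter> X" "C \<inter> Y"] p pY by simp
  have "(\<Sum>v\<in>C \<inter> X. 3 * int k) \<le> (\<Sum>v\<in>C \<inter> X. int (deg E v))"
    by (rule sum_mono) (use deg_ge a in force)
  then have l1: "3 * ?k \<le> (\<Sum>v\<in>C \<inter> X. int (deg E v))" using p by simp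
  have "(\<Sum>v\<in>C \<inter> Y. 3 * int k) \<le> (\<Sum>v\<in>C \<inter> Y. int (deg E v))"
    by (rule sum_mono) (use deg_ge a in force)
  then have l2: "3 * ?k \<le> (\<Sum>v\<in>C \<inter> Y. int (deg E v))" using pY by simp
  note s = sum_deg_split[OF C(2) DV CD, unfolded R arcs_between_empty_left arcs_between_empty_right]
  \<comment> \<open>Together the two degree sums are at least \<open>6 * ?k\<close>. They are at
    most \<open>4 * ?k\<close> from the arcs inside \<open>C\<close>, each counted twice, plus
    \<open>2 * ?k\<close> from the crossing arcs. Hence every estimate is an equality.\<close>
  show "e (C \<inter> X) (?D \<inter> Y) + e (?D \<inter> X) (C \<inter> Y) = ?k"
    "e (C \<inter> Y) (?D \<inter> X) + e (?D \<inter> Y) (C \<inter> X) = ?k"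
    "e (C \<inter> X) (?D \<inter> Y) + e (?D \<inter> Y) (C \<inter> X) = ?k"
    using cr1 cr2 i1 i2 l1 l2 s by linarith+
  have "e (C \<inter> X) (C \<inter> Y) \<ge> ?k" "e (C \<inter> Y) (C \<inter> X) \<ge> ?k"
    using cr1 cr2 i1 i2 l1 l2 s by linarith+
  then show "E x y \<and> E y x" if "x \<in> C \<inter> X" "y \<in> C \<inter> Y" for x y
    using arcs_between_full[of "C \<inter> X" "C \<inter> Y" E x y] arcs_between_full[of "C \<inter> Y" "C \<inter> X" E y x]
      that p pY finX finY by simp
qed

text \<open>Conjugating \<open>f\<close> by the transposition of \<open>f u\<close> and
  \<open>y\<close> only relabels the cycles, so the number of closed sets does not grow. Both
  swapped vertices lie in \<open>C \<inter> Y\<close>: nothing changes outside \<open>C\<close>,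
  \<open>u\<close> itself stays fixed, and new successors inside \<open>C\<close> are reached by
  arcs because \<open>C\<close> is complete.\<close>

lemma redirect_factor:
  assumes f: "cycle_factor E V f" and C: "C \<in> closed_sets f V"
    and full: "\<And>x y. x \<in> C \<inter> X \<Longrightarrow> y \<in> C \<inter> Y \<Longrightarrow> E x y \<and> E y x"
    and u: "u \<in> C \<inter> X" and y: "y \<in> C \<inter> Y"
  shows "\<exists>h. cycle_factor E V h \<and> card (closed_sets h V) \<le> card (closed_sets f V) \<and>
    C \<in> closed_sets h V \<and> h u = y \<and> (\<forall>v\<in>V - C. h v = f v)"
proof -
  define t where "t = Transposition.transpose (f u) y"
  define h where "h = t \<circ> f \<circ> t"
  have CV: "C \<subseteq> V" "f ` C \<subseteq> C" using C by (auto simp: closed_sets_def)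
  have E: "E v (f v)" if "v \<in> V" for v using f that by (auto simp: cycle_factor_def)
  have fu: "f u \<in> C \<inter> Y" using CV E[of u] bip[of u "f u"] u disj by blast
  have tt: "t (t v) = v" for v by (simp add: t_def)
  have tC: "t v \<in> C \<longleftrightarrow> v \<in> C" for v using fu y by (auto simp: t_def Transposition.transpose_def)
  have tX: "t v \<in> X \<longleftrightarrow> v \<in> X" and tY: "t v \<in> Y \<longleftrightarrow> v \<in> Y" for v
    using fu y disj by (auto simp: t_def Transposition.transpose_def)
  have tid: "t v = v" if "v \<notin> C \<inter> Y" for v using that fu y by (auto simp: t_def Transposition.transpose_def)
  have tim: "t ` S = S" if "\<And>v. t v \<in> S \<longleftrightarrow> v \<in> S" for S
    using that tt by (metis (no_types, lifting) image_eqI image_subsetI subsetI subset_antisym)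
  have "t ` V = V" by (rule tim) (use tX tY in blast)
  moreover have "inj t" using tt by (metis injI)
  ultimately have bt: "bij_betw t V V" by (metis bij_betw_def inj_on_subset subset_UNIV)
  have bf: "bij_betw f V V" using f by (simp add: cycle_factor_def)
  have "bij_betw h V V" unfolding h_def by (intro bij_betw_trans[OF _ bij_betw_trans] bt bf)
      (auto simp: comp_assoc intro: bij_betw_trans bt bf)
  moreover have out: "h v = f v" if "v \<in> V - C" for v
  proof -
    have "f v \<in> V - C" using closed_sets_Diff[OF bf finV C] that by (auto simp: closed_sets_def)
    then show ?thesis using that tid by (simp add: h_def)
  qed
  moreover have hC: "h v \<in> C" if "v \<in> C" for v using that CV tC by (auto simp: h_def)
  moreover have "E v (h v)" if "v \<in> V" for v
  proof (cases "v \<in> C")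
    case True
    have "t v \<in> V" "t v \<in> C" using True tC CV by auto
    then have "E (t v) (f (t v))" using E by blast
    then have "v \<in> X \<and> h v \<in> Y \<or> v \<in> Y \<and> h v \<in> X" using bip tX tY by (auto simp: h_def)
    then show ?thesis using full hC[OF True] True by blast
  next
    case False
    then show ?thesis using out that E by simp
  qed
  moreover have "C \<in> closed_sets h V" using hC CV by (auto simp: closed_sets_def)
  moreover have "h u = y"
  proof -
    have "t u = u" using u disj by (intro tid) blast
    then show ?thesis by (simp add: h_def t_def)
  qed
  moreover have "card (closed_sets h V) \<le> card (closed_sets f V)"
  proof (rule card_inj_on_le[of "(`) t"])
    show "inj_on ((`) t) (closed_sets h V)" using \<open>inj t\<close> by (simp add: inj_on_def inj_image_eq_iff)
    show "finite (closed_sets f V)" using finV by (rule finite_closed_sets)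
    show "(`) t ` closed_sets h V \<subseteq> closed_sets f V"
    proof
      fix R assume "R \<in> (`) t ` closed_sets h V"
      then obtain S where S: "R = t ` S" "S \<subseteq> V" "h ` S \<subseteq> S" by (auto simp: closed_sets_def)
      have "f v \<in> t ` S" if "v \<in> t ` S" for v
      proof -
        obtain s where s: "s \<in> S" "v = t s" using \<open>v \<in> t ` S\<close> by blast
        then have "t (f v) \<in> S" using S by (auto simp: h_def)
        then show ?thesis using tt by (metis image_eqI)
      qed
      moreover have "t ` S \<subseteq> V" using S(2) \<open>t ` V = V\<close> by blast
      ultimately show "R \<in> closed_sets f V" using S(1) by (auto simp: closed_sets_def)
    qed
  qed
  ultimately show ?thesis by (auto simp: cycle_factor_def)
qed

section \<open>A cycle factor with the fewest cycles is a Hamiltonian cycle\<close>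

lemma strong_arc:
  assumes "C \<subseteq> V" "C \<noteq> {}" "C \<noteq> V"
  shows "e (C \<inter> X) ((V - C) \<inter> Y) + e (C \<inter> Y) ((V - C) \<inter> X) > 0"
proof -
  obtain u v where uv: "u \<in> C" "v \<in> V - C" "E u v" using strong[OF assms] by blast
  have nn: "0 \<le> e A B" for A B unfolding arcs_between_def by (intro sum_nonneg) auto
  have pos: "0 < e A B" if "finite A" "finite B" "u \<in> A" "v \<in> B" for A B
    unfolding arcs_between_def
    by (rule sum_pos2[of A u]; (rule sum_pos2[of B v])?) (use that uv in \<open>auto intro: sum_nonneg\<close>)
  have "u \<in> C \<inter> X \<and> v \<in> (V - C) \<inter> Y \<or> u \<in> C \<inter> Y \<and> v \<in> (V - C) \<inter> X" using bip uv by blast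
  then show ?thesis
  proof
    assume "u \<in> C \<inter> X \<and> v \<in> (V - C) \<inter> Y"
    then show ?thesis using pos[of "C \<inter> X" "(V - C) \<inter> Y"] nn[of "C \<inter> Y" "(V - C) \<inter> X"] finX finY by auto
  next
    assume "u \<in> C \<inter> Y \<and> v \<in> (V - C) \<inter> X"
    then show ?thesis using pos[of "C \<inter> Y" "(V - C) \<inter> X"] nn[of "C \<inter> X" "(V - C) \<inter> Y"] finX finY by auto
  qed
qed

lemma arcs_between_nonzero:
  assumes "e A B \<noteq> 0"
  obtains u v where "u \<in> A" "v \<in> B" "E u v"
proof -
  have "\<exists>u\<in>A. \<exists>v\<in>B. E u v"
  proof (rule ccontr)
    assume "\<not> ?thesis"
    then have "e A B = 0" unfolding arcs_between_def by (intro sum.neutral ballI) auto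
    then show False using assms by simp
  qed
  then show ?thesis using that by blast
qed

theorem hamiltonian: "\<exists>f. spanning_cycle E V f"
proof (rule ccontr)
  assume non: "\<nexists>f. spanning_cycle E V f"
  obtain f where f: "cycle_factor E V f"
    and minf: "\<And>g. cycle_factor E V g \<Longrightarrow> card (closed_sets f V) \<le> card (closed_sets g V)"
    using ex_has_least_nat[of "cycle_factor E V" _ "\<lambda>f. card (closed_sets f V)"] ex_cycle_factor by metis
  \<comment> \<open>Stated for every factor \<open>h\<close> with no more closed sets than
    \<open>f\<close>, because the tight case modifies \<open>f\<close> before it merges.\<close>
  have no: "\<not> (E u (h w) \<and> E w (h u))"
    if h: "cycle_factor E V h" "card (closed_sets h V) \<le> card (closed_sets f V)"
      and C: "C \<in> closed_sets h V" and uw: "u \<in> C" "w \<in> V - C" for h C u w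
  proof
    assume E: "E u (h w) \<and> E w (h u)"
    have bij: "bij_betw h V V" using h by (simp add: cycle_factor_def)
    have "closed_sets (h(u := h w, w := h u)) V \<subset> closed_sets h V"
      using swap_closed_sets[OF bij finV C uw] C by blast
    then have "card (closed_sets (h(u := h w, w := h u)) V) < card (closed_sets h V)"
      by (rule psubset_card_mono[OF finite_closed_sets[OF finV]])
    moreover have "cycle_factor E V (h(u := h w, w := h u))"
      by (rule swap_factor) (use h C uw E in \<open>auto simp: closed_sets_def\<close>)
    ultimately show False using minf h(2) by fastforce
  qed
  have bij: "bij_betw f V V" using f by (simp add: cycle_factor_def)
  obtain C0 where C0: "C0 \<in> closed_sets f V" "C0 \<noteq> {}" "C0 \<noteq> V"
    using non f unfolding spanning_cycle_def by blast
  have C0V: "C0 \<subseteq> V" using C0 by (auto simp: closed_sets_def)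
  have "card (C0 \<inter> X) + card ((V - C0) \<inter> X) = a"
  proof -
    have "X - C0 - (V - C0) = {}" by auto
    then have "card (X - C0 - (V - C0)) = 0" by (simp only: card.empty)
    moreover have "card (C0 \<inter> X) + card ((V - C0) \<inter> X) + card (X - C0 - (V - C0)) = a"
      by (rule card_part) (use C0V in auto)
    ultimately show ?thesis by linarith
  qed
  then have "2 * card (C0 \<inter> X) \<le> a \<or> 2 * card ((V - C0) \<inter> X) \<le> a" by linarith
  then obtain C where C: "C \<in> closed_sets f V" "C \<noteq> {}" "C \<noteq> V" "2 * card (C \<inter> X) \<le> a"
  proof
    assume "2 * card (C0 \<inter> X) \<le> a"
    then show thesis using that C0 by blast
  next
    assume "2 * card ((V - C0) \<inter> X) \<le> a"
    moreover have "V - C0 \<noteq> {}" "V - C0 \<noteq> V" using C0 C0V by blast+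
    ultimately show thesis using that closed_sets_Diff[OF bij finV C0(1)] by blast
  qed
  have CV: "C \<subseteq> V" using C by (auto simp: closed_sets_def)
  let ?D = "V - C"
  have Dc: "?D \<in> closed_sets f V" by (rule closed_sets_Diff[OF bij finV C(1)])
  have facC: "cycle_factor E C f" and facD: "cycle_factor E ?D f"
    using cycle_factor_closed[OF f finV] C Dc by auto
  have noCD: "\<And>u w. u \<in> C \<Longrightarrow> w \<in> ?D \<Longrightarrow> \<not> (E u (f w) \<and> E w (f u))" using no[OF f _ C(1)] by blast
  define p where "p = int (card (C \<inter> X))"
  have ppos: "1 \<le> p"
  proof (rule ccontr)
    assume "\<not> 1 \<le> p"
    then have "card (C \<inter> X) = 0" by (simp add: p_def)
    moreover have "card (C \<inter> Y) = 0" using factor_card_eq[OF facC CV] calculation by simp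
    ultimately have "C \<inter> X = {}" "C \<inter> Y = {}" using finX finY by simp_all
    then show False using CV C(2) by blast
  qed
  define m where "m = int a - int k - p"
  have R: "X - C - ?D = {}" "Y - C - ?D = {}" by auto
  \<comment> \<open>For \<open>m \<ge> 1\<close>, \<open>no_merge_ineq\<close> with no missed
    vertices (\<open>r = 0\<close>) contradicts \<open>gap_pos\<close>. Since
    \<open>2 * p \<le> a\<close> and \<open>2 * k \<le> a\<close>, what remains is
    \<open>a = 2 * k\<close> and \<open>p = k\<close>.\<close>
  have "m < 1"
  proof (rule ccontr)
    assume "\<not> m < 1"
    then have m1: "1 \<le> m" by simp
    have lX: "int (card (C \<inter> X \<inter> low)) \<le> p" unfolding p_def
      using finX by (auto intro: card_mono)
    have lY: "int (card (C \<inter> Y \<inter> low)) \<le> p" unfolding p_def factor_card_eq[OF facC CV, symmetric]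
      using finY by (auto intro: card_mono)
    have "0 \<le> (p - 1) * (m - 1)" using ppos m1 by (intro mult_nonneg_nonneg) auto
    then have one: "0 < (p - 1) * (m - 1) + int k - 1 - 0" using k_ge by linarith
    have "p * 1 \<le> p * (p + int k - 2)" using ppos k_ge by (intro mult_left_mono) auto
    then have top: "0 < p * (p + int k - 2) - 0" using ppos by simp
    note G = gap_pos[OF ppos m1 _ _ one top]
    have "(p * m + (2 * p + 0) * max 0 (int (card (C \<inter> X \<inter> low)) - 1) - int (card (C \<inter> X \<inter> low)) * (m + p + 0 - int k))
      + (p * m + (2 * p + 0) * max 0 (int (card (C \<inter> Y \<inter> low)) - 1) - int (card (C \<inter> Y \<inter> low)) * (m + p + 0 - int k)) \<le> 0"
      by (rule no_merge_ineq[OF facC CV facD _ _ noCD]) (auto simp: p_def m_def R)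
    moreover note G[OF of_nat_0_le_iff lX] G[OF of_nat_0_le_iff lY]
    ultimately show False by linarith
  qed
  then have a: "a = 2 * k" and pk: "card (C \<inter> X) = k" using C(4) k_le by (auto simp: m_def p_def)
  note tC = no_merge_tight[OF facC CV facD noCD pk a]
  have DD: "V - ?D = C" using CV by blast
  have qk: "card (?D \<inter> X) = k" using card_part[of C ?D] CV R pk a by auto
  have noDC: "\<not> (E u (f w) \<and> E w (f u))" if "u \<in> ?D" "w \<in> V - ?D" for u w
    using noCD[of w u] that by auto
  have fullD: "\<And>x y. x \<in> ?D \<inter> X \<Longrightarrow> y \<in> ?D \<inter> Y \<Longrightarrow> E x y \<and> E y x"
    using no_merge_tight(1)[OF facD _ _ noDC qk a] facC DD by auto
  \<comment> \<open>Given \<open>u \<rightarrow> y'\<close> and \<open>w \<rightarrow> y\<close>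
    across in both directions, redirecting inside \<open>C\<close> to get \<open>h' u = y\<close>
    and inside \<open>?D\<close> to get \<open>h' w = y'\<close> makes them an exchangeable
    pair.\<close>
  have "e (C \<inter> X) (?D \<inter> Y) = 0 \<or> e (?D \<inter> X) (C \<inter> Y) = 0"
  proof (rule ccontr)
    assume "\<not> ?thesis"
    then have ne: "e (C \<inter> X) (?D \<inter> Y) \<noteq> 0" "e (?D \<inter> X) (C \<inter> Y) \<noteq> 0" by auto
    obtain u y' where uy': "u \<in> C \<inter> X" "y' \<in> ?D \<inter> Y" "E u y'" using ne(1) by (rule arcs_between_nonzero)
    obtain w y where wy: "w \<in> ?D \<inter> X" "y \<in> C \<inter> Y" "E w y" using ne(2) by (rule arcs_between_nonzero)
    note mem = uy'(1,2) wy(1,2)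
    obtain h where h: "cycle_factor E V h" "card (closed_sets h V) \<le> card (closed_sets f V)"
      "C \<in> closed_sets h V" "h u = y" "\<And>v. v \<in> V - C \<Longrightarrow> h v = f v"
      using redirect_factor[OF f C(1) tC(1) mem(1,4)] by blast
    have bh: "bij_betw h V V" using h by (simp add: cycle_factor_def)
    obtain h' where h': "cycle_factor E V h'" "card (closed_sets h' V) \<le> card (closed_sets h V)"
      "?D \<in> closed_sets h' V" "h' w = y'" "\<And>v. v \<in> V - ?D \<Longrightarrow> h' v = h v"
      using redirect_factor[OF h(1) closed_sets_Diff[OF bh finV h(3)] fullD mem(3,2)] by blast
    have "h' u = y" using h'(5)[of u] h(4) mem DD by auto
    then show False using no[OF h'(1) _ h'(3), of w u] h'(2,4) h(2) uy'(3) wy(3) mem DD by auto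
  qed
  \<comment> \<open>The equalities for the crossing arcs turn one empty class into two, so that no
    arc leaves \<open>C\<close>, or none leaves \<open>?D\<close>.\<close>
  then show False
  proof
    assume "e (C \<inter> X) (?D \<inter> Y) = 0"
    then have "e (C \<inter> X) (?D \<inter> Y) + e (C \<inter> Y) (?D \<inter> X) = 0" using tC(3,4) by linarith
    then show False using strong_arc[OF CV C(2,3)] by simp
  next
    assume "e (?D \<inter> X) (C \<inter> Y) = 0"
    then have "e (?D \<inter> X) (C \<inter> Y) + e (?D \<inter> Y) (C \<inter> X) = 0" using tC(2,4) by linarith
    moreover have "?D \<noteq> {}" "?D \<noteq> V" using CV C by blast+
    ultimately show False using strong_arc[of ?D] unfolding DD by auto
  qed
qed

end

section \<open>Shorter cycles\<close>

lemma spanning_cycle_segment: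
  assumes "i \<le> j" "inj_on r {i..j}" and E: "\<And>l. i \<le> l \<Longrightarrow> l < j \<Longrightarrow> E (r l) (r (Suc l))" and "E (r j) (r i)"
  shows "\<exists>g. spanning_cycle E (r ` {i..j}) g"
proof -
  have im: "(\<lambda>l. r (i + l)) ` {..<Suc (j - i)} = r ` {i..j}"
  proof
    show "r ` {i..j} \<subseteq> (\<lambda>l. r (i + l)) ` {..<Suc (j - i)}"
    proof
      fix v assume "v \<in> r ` {i..j}"
      then obtain l where "v = r l" "i \<le> l" "l \<le> j" by auto
      then show "v \<in> (\<lambda>l. r (i + l)) ` {..<Suc (j - i)}" by (intro image_eqI[of _ _ "l - i"]) auto
    qed
  qed (use assms(1) in auto)
  have "\<exists>g. spanning_cycle E ((\<lambda>l. r (i + l)) ` {..<Suc (j - i)}) g"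
  proof (rule spanning_cycle_of_seq)
    show "inj_on (\<lambda>l. r (i + l)) {..<Suc (j - i)}"
    proof (rule inj_onI)
      fix l l' assume l: "l \<in> {..<Suc (j - i)}" "l' \<in> {..<Suc (j - i)}" "r (i + l) = r (i + l')"
      then have "i + l = i + l'" using assms(1) by (intro inj_onD[OF assms(2)]) auto
      then show "l = l'" by simp
    qed
    show "E (r (i + l)) (r (i + Suc l))" if "Suc l < Suc (j - i)" for l using E[of "i + l"] that by simp
  qed (use assms in auto)
  then show ?thesis by (simp only: im)
qed

lemma sum_even_odd: "(\<Sum>t<2 * n. g t) = (\<Sum>i<n. g (2 * i) + g (2 * i + 1))" for g :: "nat \<Rightarrow> nat"
  by (induction n) auto

context dominated_bipartite
begin

section \<open>A cycle missing one vertex of each part\<close>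

definition has_cycle :: "nat \<Rightarrow> bool" where
  "has_cycle n \<longleftrightarrow> (\<exists>C f. C \<subseteq> V \<and> card C = n \<and> spanning_cycle E C f)"

definition near_hamiltonian :: bool where
  "near_hamiltonian \<longleftrightarrow> (\<exists>x\<in>X. \<exists>y\<in>Y. \<exists>f. spanning_cycle E (V - {x, y}) f)"

lemma near_hamiltonian_merge:
  assumes C: "spanning_cycle E C f" and D: "spanning_cycle E D g" and CD: "C \<inter> D = {}"
    and x: "x \<in> X" and y: "y \<in> Y" and un: "C \<union> D = V - {x, y}"
    and "u \<in> C" "w \<in> D" "E u (g w)" "E w (f u)"
  shows near_hamiltonian
proof -
  have "finite (C \<union> D)" unfolding un using finV by simp
  then have "finite C" "finite D" by simp_all
  then have "\<exists>h. spanning_cycle E (C \<union> D) h" using merge_spanning_cycles[OF C D] assms by blast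
  then show ?thesis unfolding un near_hamiltonian_def using x y by blast
qed

text \<open>The boundary case of the count: the degrees of \<open>u\<close> and \<open>w\<close> add
  up to at least \<open>2 * a + 4\<close>, while inside the 2-cycle they collect 4, across to
  \<open>D\<close> at most \<open>2 * (a - 2)\<close> by the pairing, and with \<open>x\<close> and
  \<open>y\<close> at most 4. So all these arcs exist.\<close>

lemma two_cycle_tight:
  assumes D: "spanning_cycle E D g" and k: "k = 2" and non: "\<not> near_hamiltonian"
    and X: "u \<in> X" "x \<in> X" "u \<noteq> x" and Y: "w \<in> Y" "y \<in> Y" "w \<noteq> y"
    and Deq: "D = V - {u, w, x, y}" and uw: "E u w" "E w u"
  shows "deg E w = a + 2 \<and> E u y \<and> E y u"
proof -
  interpret sw: dominated_bipartite E Y X a k by (rule swap)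
  have ne: "u \<noteq> w" "x \<noteq> y" "u \<noteq> y" "x \<noteq> w" using X Y disj by blast+
  let ?C = "{u, w}"
  have "\<exists>f. spanning_cycle E ((\<lambda>i::nat. if i = 0 then u else w) ` {..<2}) f"
    by (rule spanning_cycle_of_seq) (use uw ne in \<open>auto simp: inj_on_def\<close>)
  moreover have "(\<lambda>i::nat. if i = 0 then u else w) ` {..<2} = ?C"
  proof -
    have "{..<2} = {0, 1::nat}" by auto
    then show ?thesis by auto
  qed
  ultimately obtain f where f: "spanning_cycle E ?C f" by auto
  have CD: "?C \<inter> D = {}" and un: "?C \<union> D = V - {x, y}" using Deq X Y ne by auto
  have no: "\<not> (E u' (g w') \<and> E w' (f u'))" if "u' \<in> ?C" "w' \<in> D" for u' w'
    using near_hamiltonian_merge[OF f D CD X(2) Y(2) un that] non by blast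
  have fac: "cycle_factor E ?C f" "cycle_factor E D g" using f D by (auto simp: spanning_cycle_def)
  have CV: "?C \<subseteq> V" and DV: "D \<subseteq> V" using X Y Deq by auto
  have sets: "?C \<inter> X = {u}" "?C \<inter> Y = {w}" "X - ?C - D = {x}" "Y - ?C - D = {y}"
    using X Y disj Deq ne by auto
  have q: "int (card (D \<inter> X)) = int a - 2" using card_part[OF CV DV CD] unfolding sets by simp
  have qY: "int (card (D \<inter> Y)) = int a - 2" using factor_card_eq[OF fac(2) DV] q by simp
  have cr1: "e {u} (D \<inter> Y) + e (D \<inter> X) {w} \<le> int a - 2"
    using cross_arcs_le[OF fac(1) CV fac(2) DV no] q unfolding sets by simp
  have cr2: "e {w} (D \<inter> X) + e (D \<inter> Y) {u} \<le> int a - 2"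
    using sw.cross_arcs_le[OF fac(1) _ fac(2) _ no] CV DV qY unfolding sets by (simp add: Un_commute)
  have sng: "e {s} {t} = of_bool (E s t)" for s t by (simp add: arcs_between_def)
  note s = sum_deg_split[OF CV DV CD, unfolded sets sng]
  have b: "of_bool P \<le> (1::int)" for P by simp
  have "a + 2 \<le> deg E u" "a + 2 \<le> deg E w" using deg_ge[of u] deg_ge[of w] X Y k by auto
  moreover have "int (deg E u) + int (deg E w) \<le> 2 * int a + of_bool (E u y) + of_bool (E y u)
      + of_bool (E w x) + of_bool (E x w)"
    using s cr1 cr2 uw by simp
  ultimately have "int (deg E w) = int a + 2" "of_bool (E u y) = (1::int)" "of_bool (E y u) = (1::int)"
    using b[of "E u y"] b[of "E y u"] b[of "E w x"] b[of "E x w"] by linarith+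
  then show ?thesis by simp
qed

lemma near_hamiltonian_of_two_cycles:
  assumes C: "spanning_cycle E C f" and D: "spanning_cycle E D g" and CD: "C \<inter> D = {}"
    and x: "x \<in> X" and y: "y \<in> Y" and un: "C \<union> D = V - {x, y}"
    and p: "1 \<le> card (C \<inter> X)" "2 * card (C \<inter> X) + 3 \<le> a" and a: "5 \<le> a"
  shows near_hamiltonian
proof (rule ccontr)
  assume non: "\<not> near_hamiltonian"
  have no: "\<not> (E u (g w) \<and> E w (f u))" if "u \<in> C" "w \<in> D" for u w
    using near_hamiltonian_merge[OF C D CD x y un that] non by blast
  have fac: "cycle_factor E C f" "cycle_factor E D g" using C D by (auto simp: spanning_cycle_def)
  have CV: "C \<subseteq> V" and DV: "D \<subseteq> V" using un by auto
  have Rx: "X - C - D = {x}" using un x y disj by blast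
  define p where "p = int (card (C \<inter> X))"
  have p1: "1 \<le> p" "2 * p + 3 \<le> int a" using p by (auto simp: p_def)
  \<comment> \<open>With \<open>r = 1\<close> the two end point conditions of \<open>gap_pos\<close>
    fail only for \<open>k = 2\<close> and \<open>p = 1\<close>, where both values are 0; this case
    needs the structure around the 2-cycle.\<close>
  show False
  proof (cases "k = 2 \<and> p = 1")
    case True
    then have "card (C \<inter> X) = 1" "card (C \<inter> Y) = 1" using factor_card_eq[OF fac(1) CV] by (auto simp: p_def)
    then obtain u w where uw: "C \<inter> X = {u}" "C \<inter> Y = {w}" by (auto simp: card_1_singleton_iff)
    then have Ceq: "C = {u, w}" using CV by blast
    have in0: "u \<in> C \<inter> X" "w \<in> C \<inter> Y" using uw by auto
    have "x \<notin> C" "y \<notin> C" using un by auto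
    then have mem: "u \<in> X" "w \<in> Y" "u \<noteq> x" "w \<noteq> y" "u \<noteq> w" using in0 disj by auto
    have "E u (f u)" "E w (f w)" "f u \<in> C" "f w \<in> C" using fac Ceq by (auto simp: cycle_factor_def bij_betw_def)
    then have E: "E u w" "E w u" using Ceq mem bip[of u "f u"] bip[of w "f w"] disj by auto
    have "D = C \<union> D - C" using CD by blast
    also have "\<dots> = V - {u, w, x, y}" unfolding un unfolding Ceq by blast
    finally have Deq: "D = V - {u, w, x, y}" .
    have t: "deg E w = a + 2 \<and> E u y \<and> E y u"
      by (rule two_cycle_tight[OF D _ non _ x _ _ y _ Deq E]) (use mem True in auto)
    \<comment> \<open>As \<open>u\<close> and \<open>y\<close> are joined both ways,
      \<open>w\<close> and \<open>y\<close> can change roles: \<open>{u, y}\<close> becomes the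
      2-cycle and \<open>w\<close> a missed vertex. Thus \<open>u\<close> dominates two vertices of
      degree \<open>a + 2\<close>, which is less than \<open>2 * a - 2\<close> for
      \<open>a \<ge> 5\<close>.\<close>
    have Deq': "D = V - {u, y, x, w}" using Deq by blast
    have t': "deg E y = a + 2"
    proof -
      have kk: "k = 2" and yw: "y \<noteq> w" using True mem by auto
      show ?thesis
        using two_cycle_tight[OF D kk non mem(1) x mem(3) y mem(2) yw Deq'] t by blast
    qed
    have "2 * a - k \<le> deg E w \<or> 2 * a - k \<le> deg E y"
      using dominated[OF E(1), of y] t mem by blast
    then show False using t t' True a by auto
  next
    case False
    define m where "m = int a - int k - p - 1"
    have m1: "1 \<le> m" using p1 k_le by (simp add: m_def)
    have prod: "0 \<le> (p - 1) * (m - 1)" using p1 m1 by (intro mult_nonneg_nonneg) auto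
    have one: "0 < (p - 1) * (m - 1) + int k - 1 - 1"
    proof (cases "k = 2")
      case True
      \<comment> \<open>Here \<open>p \<ge> 2\<close>, and \<open>m = a - 3 - p \<ge> p\<close> by
        the size bound on \<open>C\<close>.\<close>
      then have "1 \<le> p - 1" "1 \<le> m - 1" using False p1 by (auto simp: m_def)
      then have "1 * 1 \<le> (p - 1) * (m - 1)" by (intro mult_mono) auto
      then show ?thesis using True by simp
    qed (use prod k_ge in auto)
    have top: "0 < p * (p + int k - 2) - 1"
    proof -
      have "1 * 2 \<le> p * (p + int k - 2)" using False p1 k_ge by (intro mult_mono) auto
      then show ?thesis by simp
    qed
    have lX: "int (card (C \<inter> X \<inter> low)) \<le> p" unfolding p_def
      using finX by (auto intro: card_mono)
    have lY: "int (card (C \<inter> Y \<inter> low)) \<le> p" unfolding p_def factor_card_eq[OF fac(1) CV, symmetric]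
      using finY by (auto intro: card_mono)
    note G = gap_pos[OF p1(1) m1 _ _ one top]
    have "(p * m + (2 * p + 1) * max 0 (int (card (C \<inter> X \<inter> low)) - 1) - int (card (C \<inter> X \<inter> low)) * (m + p + 1 - int k))
      + (p * m + (2 * p + 1) * max 0 (int (card (C \<inter> Y \<inter> low)) - 1) - int (card (C \<inter> Y \<inter> low)) * (m + p + 1 - int k)) \<le> 0"
      by (rule no_merge_ineq[OF fac(1) CV fac(2) DV CD no]) (auto simp: p_def m_def Rx)
    moreover note G[OF of_nat_0_le_iff lX] G[OF of_nat_0_le_iff lY]
    ultimately show False by linarith
  qed
qed

section \<open>Arcs sorted by their distance along a Hamiltonian cycle\<close>

definition jumps :: "('a \<Rightarrow> 'a) \<Rightarrow> nat \<Rightarrow> nat" where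
  "jumps f t = card {v \<in> V. E v ((f ^^ t) v)}"

lemma card_V: "card V = 2 * a"
  using finX finY disj cardX cardY by (simp add: card_Un_disjoint)

lemma jumps_le: "jumps f t \<le> 2 * a"
  unfolding jumps_def card_V[symmetric] by (rule card_mono[OF finV]) auto

lemma funpow_mem:
  assumes "cycle_factor E C f" "v \<in> C"
  shows "(f ^^ t) v \<in> C"
  using bij_betw_funpow[of f C t] assms by (auto simp: cycle_factor_def bij_betw_def)

lemma funpow_side:
  assumes "cycle_factor E C f" "v \<in> C" "C \<subseteq> V"
  shows "(f ^^ t) v \<in> X \<longleftrightarrow> (v \<in> X \<longleftrightarrow> even t)"
proof (induction t)
  case (Suc t)
  have "E ((f ^^ t) v) ((f ^^ Suc t) v)"
    using funpow_mem[OF assms(1,2), of t] assms(1) by (simp add: cycle_factor_def)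
  then show ?case using Suc bip disj by (metis disjoint_iff even_Suc)
qed auto

lemma jumps_even:
  assumes "cycle_factor E V f" "even t"
  shows "jumps f t = 0"
proof -
  have "\<not> E v ((f ^^ t) v)" if "v \<in> V" for v
    using funpow_side[OF assms(1) that, of t] assms(2) bip[of v "(f ^^ t) v"] disj that by auto
  then show ?thesis unfolding jumps_def by (metis (no_types, lifting) Collect_empty_eq card.empty)
qed

lemma sum_out_degrees: "2 * (\<Sum>v\<in>V. card {w. E v w}) = (\<Sum>v\<in>V. deg E v)"
proof -
  have "{w. E v w} = {w \<in> V. E v w}" "{w. E w v} = {w \<in> V. E w v}" for v using bip by blast+
  then have *: "card {w. E v w} = (\<Sum>w\<in>V. of_bool (E v w))" "card {w. E w v} = (\<Sum>w\<in>V. of_bool (E w v))" for v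
    using finV by (simp_all add: sum_of_bool_eq Int_def)
  have "(\<Sum>v\<in>V. card {w. E w v}) = (\<Sum>v\<in>V. card {w. E v w})"
    unfolding * by (rule sum.swap)
  then show ?thesis unfolding deg_def by (simp add: sum.distrib)
qed

text \<open>Every arc from \<open>v\<close> ends at \<open>(f ^^ t) v\<close> for exactly one
  \<open>t < 2 * a\<close>, and this \<open>t\<close> is odd because the arc changes sides. So the
  jumps count each arc once.\<close>

lemma sum_jumps:
  assumes f: "spanning_cycle E V f"
  shows "2 * (\<Sum>i<a. jumps f (2 * i + 1)) = (\<Sum>v\<in>V. deg E v)"
proof -
  have fac: "cycle_factor E V f" using f by (simp add: spanning_cycle_def)
  have out: "card {w. E v w} = (\<Sum>t<2 * a. of_bool (E v ((f ^^ t) v)))" if v: "v \<in> V" for v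
  proof -
    have "bij_betw (\<lambda>t. (f ^^ t) v) {..<2 * a} V"
      using spanning_cycle_inj_on[OF f finV v] spanning_cycle_range[OF f finV v]
      by (simp add: bij_betw_def card_V)
    then have "(\<Sum>t<2 * a. of_bool (E v ((f ^^ t) v))) = (\<Sum>w\<in>V. (of_bool (E v w) :: nat))"
      by (rule sum.reindex_bij_betw)
    also have "\<dots> = card {w \<in> V. E v w}" using finV by (simp add: sum_of_bool_eq Int_def)
    also have "{w \<in> V. E v w} = {w. E v w}" using bip by blast
    finally show ?thesis by simp
  qed
  have "(\<Sum>v\<in>V. card {w. E v w}) = (\<Sum>v\<in>V. \<Sum>t<2 * a. of_bool (E v ((f ^^ t) v)))"
    by (rule sum.cong[OF refl]) (rule out)
  also have "\<dots> = (\<Sum>t<2 * a. \<Sum>v\<in>V. of_bool (E v ((f ^^ t) v)))" by (rule sum.swap)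
  also have "\<dots> = (\<Sum>t<2 * a. jumps f t)"
    using finV by (simp add: jumps_def sum_of_bool_eq Int_def)
  also have "\<dots> = (\<Sum>i<a. jumps f (2 * i + 1))"
    unfolding sum_even_odd using jumps_even[OF fac] by simp
  finally show ?thesis using sum_out_degrees by simp
qed

text \<open>An arc from \<open>z\<close> to its third successor bypasses two consecutive vertices.
  The sequence \<open>r\<close> starts at \<open>f z\<close>, so these are \<open>r 0\<close> and
  \<open>r 1\<close>, and \<open>z\<close> itself is the last term.\<close>

lemma near_hamiltonian_of_jump3:
  assumes f: "spanning_cycle E V f" and "jumps f 3 \<noteq> 0"
  shows near_hamiltonian
proof -
  have fac: "cycle_factor E V f" using f by (simp add: spanning_cycle_def)
  obtain z where z: "z \<in> V" "E z ((f ^^ 3) z)"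
  proof -
    have "{v \<in> V. E v ((f ^^ 3) v)} \<noteq> {}" using assms(2) unfolding jumps_def by (metis card.empty)
    then show thesis using that by blast
  qed
  define r where "r = (\<lambda>i. (f ^^ i) (f z))"
  have fz: "f z \<in> V" using funpow_mem[OF fac z(1), of 1] by simp
  have inj: "inj_on r {..<2 * a}" and ran: "r ` {..<2 * a} = V"
    using spanning_cycle_inj_on[OF f finV fz] spanning_cycle_range[OF f finV fz] by (simp_all add: r_def card_V)
  have rz: "r i = (f ^^ Suc i) z" for i by (simp add: r_def funpow_swap1)
  have a4: "4 \<le> a" using k_ge k_le by simp
  have "r (2 * a - 1) = z" using spanning_cycle_period[OF f finV z(1)] a4 by (simp add: rz card_V)
  then have "E (r (2 * a - 1)) (r 2)" using z(2) by (simp add: rz numeral_3_eq_3 numeral_2_eq_2)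
  moreover have "E (r l) (r (Suc l))" for l
    using funpow_mem[OF fac fz, of l] fac by (simp add: r_def cycle_factor_def)
  ultimately have "\<exists>g. spanning_cycle E (r ` {2..2 * a - 1}) g"
    by (intro spanning_cycle_segment inj_on_subset[OF inj]) (use a4 in auto)
  moreover have "r ` {2..2 * a - 1} = V - {r 0, r 1}"
  proof -
    have "{2..2 * a - 1} = {..<2 * a} - {0, 1}" using a4 by auto
    then show ?thesis using inj_on_image_set_diff[OF inj, of "{..<2 * a}" "{0, 1}"] ran a4 by simp
  qed
  moreover have "r 0 \<in> V" "r 1 \<in> V" using ran a4 by auto
  moreover have "r 0 \<in> X \<longleftrightarrow> r 1 \<notin> X" using funpow_side[OF fac fz, of 1] by (simp add: r_def)
  ultimately show ?thesis unfolding near_hamiltonian_def using disj by (metis Un_iff insert_commute)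
qed

text \<open>By pigeonhole some \<open>z\<close> lies in both \<open>?A\<close> and
  \<open>?B\<close>, where \<open>?B\<close> is a translate of the set counted by
  \<open>jumps f t'\<close>. Because \<open>(t - 2) + t' = 2 * a + 2\<close>, the arc given by
  \<open>?B\<close> ends at the second successor of \<open>z\<close>.\<close>

lemma near_hamiltonian_of_jumps:
  assumes f: "spanning_cycle E V f" and a5: "5 \<le> a" and t: "odd t" "5 \<le> t" "t \<le> 2 * a - 1"
    and mid: "t \<le> a \<or> a + 4 \<le> t" and many: "2 * a < jumps f t + jumps f (2 * a + 4 - t)"
  shows near_hamiltonian
proof -
  have fac: "cycle_factor E V f" using f by (simp add: spanning_cycle_def)
  have bij: "bij_betw (f ^^ s) V V" for s using fac by (intro bij_betw_funpow) (simp add: cycle_factor_def)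
  define t' where "t' = 2 * a + 4 - t"
  let ?A = "{z \<in> V. E z ((f ^^ t) z)}"
  let ?B = "{z \<in> V. E ((f ^^ (t - 2)) z) ((f ^^ t') ((f ^^ (t - 2)) z))}"
  have im: "(f ^^ (t - 2)) ` ?B = {v \<in> V. E v ((f ^^ t') v)}"
  proof
    show "(f ^^ (t - 2)) ` ?B \<subseteq> {v \<in> V. E v ((f ^^ t') v)}" using bij[of "t - 2"] by (auto simp: bij_betw_def)
    show "{v \<in> V. E v ((f ^^ t') v)} \<subseteq> (f ^^ (t - 2)) ` ?B"
    proof
      fix v assume v: "v \<in> {v \<in> V. E v ((f ^^ t') v)}"
      then obtain z where "z \<in> V" "v = (f ^^ (t - 2)) z" using bij[of "t - 2"] by (auto simp: bij_betw_def)
      then show "v \<in> (f ^^ (t - 2)) ` ?B" using v by blast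
    qed
  qed
  have "inj_on (f ^^ (t - 2)) V" using bij[of "t - 2"] by (simp add: bij_betw_def)
  then have "inj_on (f ^^ (t - 2)) ?B" by (rule inj_on_subset) blast
  then have "card ((f ^^ (t - 2)) ` ?B) = card ?B" by (rule card_image)
  then have "card ?B = jumps f t'" unfolding im jumps_def by (rule sym)
  then have "card V < card ?A + card ?B" using many by (simp add: jumps_def card_V t'_def)
  moreover have "card (?A \<union> ?B) \<le> card V" by (rule card_mono[OF finV]) auto
  moreover have "card ?A + card ?B = card (?A \<union> ?B) + card (?A \<inter> ?B)"
    using finV by (intro card_Un_Int) auto
  ultimately have "card (?A \<inter> ?B) \<noteq> 0" by linarith
  then have "?A \<inter> ?B \<noteq> {}" by (metis card.empty)
  then obtain z where z: "z \<in> V" "E z ((f ^^ t) z)" "E ((f ^^ (t - 2)) z) ((f ^^ t') ((f ^^ (t - 2)) z))"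
    by blast
  \<comment> \<open>With indices starting at \<open>f z\<close>, the two arcs close the segments
    \<open>r 1\<close>, ..., \<open>r (t - 3)\<close> and \<open>r (t - 1)\<close>, ...,
    \<open>r (2 * a - 1)\<close>, which leave out \<open>r 0\<close> and
    \<open>r (t - 2)\<close>.\<close>
  define r where "r = (\<lambda>i. (f ^^ i) (f z))"
  have fz: "f z \<in> V" using funpow_mem[OF fac z(1), of 1] by simp
  have inj: "inj_on r {..<2 * a}" and ran: "r ` {..<2 * a} = V"
    using spanning_cycle_inj_on[OF f finV fz] spanning_cycle_range[OF f finV fz] by (simp_all add: r_def card_V)
  have rz: "r i = (f ^^ Suc i) z" for i by (simp add: r_def funpow_swap1)
  have per: "(f ^^ (2 * a)) z = z" using spanning_cycle_period[OF f finV z(1)] by (simp add: card_V)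
  have step: "E (r l) (r (Suc l))" for l
    using funpow_mem[OF fac fz, of l] fac by (simp add: r_def cycle_factor_def)
  have "(f ^^ t') ((f ^^ (t - 2)) z) = (f ^^ (2 + 2 * a)) z"
  proof -
    have "t' + (t - 2) = 2 + 2 * a" using t by (simp add: t'_def)
    then have "f ^^ (2 + 2 * a) = f ^^ t' \<circ> f ^^ (t - 2)" by (simp only: funpow_add[symmetric])
    then show ?thesis by simp
  qed
  also have "\<dots> = (f ^^ 2) z" by (simp only: funpow_add comp_apply per)
  finally have "(f ^^ t') ((f ^^ (t - 2)) z) = r 1" by (simp add: rz numeral_2_eq_2)
  moreover have "(f ^^ (t - 2)) z = r (t - 3)" using t by (simp add: rz Suc_diff_Suc numeral_3_eq_3 numeral_2_eq_2)
  ultimately have E1: "E (r (t - 3)) (r 1)" using z(3) by simp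
  have "r (2 * a - 1) = z" "r (t - 1) = (f ^^ t) z" using per a5 t by (simp_all add: rz)
  then have E2: "E (r (2 * a - 1)) (r (t - 1))" using z(2) by simp
  let ?C = "r ` {1..t - 3}" and ?D = "r ` {t - 1..2 * a - 1}"
  have "\<exists>g. spanning_cycle E ?C g"
    by (intro spanning_cycle_segment inj_on_subset[OF inj] step E1) (use t in auto)
  then obtain g where g: "spanning_cycle E ?C g" by blast
  have "\<exists>h. spanning_cycle E ?D h"
    by (intro spanning_cycle_segment inj_on_subset[OF inj] step E2) (use t in auto)
  then obtain h where h: "spanning_cycle E ?D h" by blast
  have CD: "?C \<inter> ?D = {}"
  proof -
    have "r ` ({1..t - 3} \<inter> {t - 1..2 * a - 1}) = ?C \<inter> ?D"
      by (rule inj_on_image_Int[OF inj]) (use t in auto)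
    moreover have "{1..t - 3} \<inter> {t - 1..2 * a - 1} = {}" using t by auto
    ultimately show ?thesis by simp
  qed
  have un: "?C \<union> ?D = V - {r 0, r (t - 2)}"
  proof -
    have "{1..t - 3} \<union> {t - 1..2 * a - 1} = {..<2 * a} - {0, t - 2}" using t by auto
    then have "?C \<union> ?D = r ` ({..<2 * a} - {0, t - 2})" by (simp only: image_Un[symmetric])
    also have "\<dots> = V - {r 0, r (t - 2)}"
      using inj_on_image_set_diff[OF inj, of "{..<2 * a}" "{0, t - 2}"] ran t a5 by simp
    finally show ?thesis .
  qed
  have "r 0 \<in> V" "r (t - 2) \<in> V" using ran a5 t by auto
  moreover have "r 0 \<in> X \<longleftrightarrow> r (t - 2) \<notin> X"
    using funpow_side[OF fac fz, of "t - 2"] t by (simp add: r_def)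
  ultimately obtain x y where xy: "x \<in> X" "y \<in> Y" "{r 0, r (t - 2)} = {x, y}"
    by (metis Un_iff insert_commute)
  have half: "2 * card (S \<inter> X) = card S" if "spanning_cycle E S s" "S \<subseteq> V" for S s
  proof -
    have "card (S \<inter> Y) = card (S \<inter> X)" using factor_card_eq that by (auto simp: spanning_cycle_def)
    moreover have "card (S \<inter> X \<union> S \<inter> Y) = card (S \<inter> X) + card (S \<inter> Y)"
      by (rule card_Un_disjoint) (use finX finY disj in auto)
    moreover have "S \<inter> X \<union> S \<inter> Y = S" using that by blast
    ultimately show ?thesis by simp
  qed
  have CV: "?C \<subseteq> V" "?D \<subseteq> V" using un by auto
  have cC: "card ?C = t - 3"
  proof -
    have "inj_on r {1..t - 3}" by (rule inj_on_subset[OF inj]) (use t in auto)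
    then show ?thesis by (simp add: card_image)
  qed
  have cD: "card ?D = 2 * a - 1 - (t - 1) + 1"
  proof -
    have "inj_on r {t - 1..2 * a - 1}" by (rule inj_on_subset[OF inj]) (use t in auto)
    then show ?thesis using t by (simp add: card_image)
  qed
  have un': "?C \<union> ?D = V - {x, y}" using un unfolding xy(3) .
  \<comment> \<open>The segments have \<open>t - 3\<close> and \<open>2 * a + 1 - t\<close>
    vertices, so \<open>mid\<close> is exactly the size bound of
    \<open>near_hamiltonian_of_two_cycles\<close> for one of them, which then plays the role of
    \<open>C\<close>.\<close>
  show ?thesis
  proof (cases "t \<le> a")
    case True
    have "1 \<le> card (?C \<inter> X)" "2 * card (?C \<inter> X) + 3 \<le> a"
      using half[OF g CV(1)] cC t True by linarith+
    then show ?thesis by (rule near_hamiltonian_of_two_cycles[OF g h CD xy(1,2) un' _ _ a5])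
  next
    case False
    then have "a + 4 \<le> t" using mid by simp
    then have "1 \<le> card (?D \<inter> X)" "2 * card (?D \<inter> X) + 3 \<le> a"
      using half[OF h CV(2)] cD t by linarith+
    moreover have "?D \<inter> ?C = {}" "?D \<union> ?C = V - {x, y}" using CD un' by (simp_all only: Int_commute Un_commute)
    ultimately show ?thesis by (intro near_hamiltonian_of_two_cycles[OF h g _ xy(1,2) _ _ _ a5])
  qed
qed

text \<open>The strictness decides the final count. For \<open>k \<ge> 3\<close> every degree
  exceeds \<open>a + 2\<close>; for \<open>k = 2\<close> a dominated pair contains a vertex of
  degree at least \<open>2 * a - 2\<close>, which exceeds \<open>a + 2\<close> once
  \<open>a \<ge> 5\<close>.\<close>

lemma degree_excess:
  assumes "5 \<le> a"
  shows "2 * a * (a + 2) < (\<Sum>v\<in>V. deg E v)"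
proof -
  have "\<exists>v\<in>V. a + 2 < deg E v"
  proof -
    have "X \<noteq> {}" using assms cardX by auto
    then obtain v where v: "v \<in> X" by blast
    have "card {w. E w v} \<le> a" using nbh_X[OF v] finY cardY by (metis card_mono)
    then have "2 \<le> card {w. E v w}" using deg_ge[of v] v k_ge by (simp add: deg_def)
    then obtain u w where uw: "E v u" "E v w" "u \<noteq> w"
      by (metis (no_types, lifting) card_le_Suc0_iff_eq card.infinite mem_Collect_eq not_less_eq_eq
          numeral_2_eq_2 le_zero_eq nat.distinct(1))
    have "u \<in> V" "w \<in> V" using uw bip by blast+
    moreover have "a + 2 < deg E u \<or> a + 2 < deg E w"
    proof (cases "k = 2")
      case True
      then show ?thesis using dominated[OF uw] assms by auto
    next
      case False
      then show ?thesis using deg_ge[of u] calculation(1) k_ge by auto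
    qed
    ultimately show ?thesis by blast
  qed
  moreover have "a + 2 \<le> deg E v" if "v \<in> V" for v using deg_ge[OF that] k_ge by simp
  ultimately have "(\<Sum>v\<in>V. a + 2) < (\<Sum>v\<in>V. deg E v)" using finV by (intro sum_strict_mono_ex1) auto
  then show ?thesis by (simp add: card_V)
qed

lemma near_hamiltonian_large:
  assumes f: "spanning_cycle E V f" and a5: "5 \<le> a"
  shows near_hamiltonian
proof (rule ccontr)
  assume non: "\<not> near_hamiltonian"
  define K where "K = (\<lambda>i. jumps f (2 * i + 1))"
  \<comment> \<open>\<open>M\<close> contains every \<open>i\<close> with \<open>2 * i + 1\<close>
    strictly between \<open>a\<close> and \<open>a + 4\<close>; for these only the trivial bound on
    jumps is used.\<close>
  define M where "M = {a div 2, a div 2 + 1}"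
  have K1: "K 1 = 0" using near_hamiltonian_of_jump3[OF f] non by (auto simp: K_def)
  \<comment> \<open>For \<open>t = 2 * i + 1\<close> the partner \<open>2 * a + 4 - t\<close> has
    index \<open>a + 1 - i\<close>, written in the form that reversing the sum produces.\<close>
  have pair: "K i + K (a - 1 + 2 - i) \<le> 2 * a + (if i \<in> M then 2 * a else 0)" if i: "i \<in> {2..a - 1}" for i
  proof (cases "i \<in> M")
    case True
    then show ?thesis using jumps_le[of f "2 * i + 1"] jumps_le[of f "2 * (a - 1 + 2 - i) + 1"] by (simp add: K_def)
  next
    case False
    then have "2 * i + 1 \<le> a \<or> a + 4 \<le> 2 * i + 1" unfolding M_def by (simp) presburger
    moreover have "2 * a + 4 - (2 * i + 1) = 2 * (a - 1 + 2 - i) + 1" using i by auto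
    moreover have "5 \<le> 2 * i + 1" "2 * i + 1 \<le> 2 * a - 1" using i by auto
    ultimately have "\<not> 2 * a < K i + K (a - 1 + 2 - i)"
      using near_hamiltonian_of_jumps[OF f a5, of "2 * i + 1"] non unfolding K_def by auto
    then show ?thesis using False by simp
  qed
  have "2 * (\<Sum>i=2..a - 1. K i) = (\<Sum>i=2..a - 1. K i) + (\<Sum>i=2..a - 1. K (a - 1 + 2 - i))"
    using sum.atLeastAtMost_rev[of K 2 "a - 1"] by (simp only: mult_2)
  also have "\<dots> = (\<Sum>i=2..a - 1. K i + K (a - 1 + 2 - i))" by (simp only: sum.distrib)
  also have "\<dots> \<le> (\<Sum>i=2..a - 1. 2 * a + (if i \<in> M then 2 * a else 0))" by (rule sum_mono) (rule pair)
  also have "\<dots> = 2 * a * (a - 2) + 2 * a * card ({2..a - 1} \<inter> M)"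
    using a5 by (simp add: sum.distrib sum.If_cases algebra_simps)
  also have "\<dots> \<le> 2 * a * (a - 2) + 2 * a * 2"
  proof -
    have "card ({2..a - 1} \<inter> M) \<le> card M" by (rule card_mono) (auto simp: M_def)
    also have "\<dots> \<le> 2" by (simp add: M_def)
    finally show ?thesis by simp
  qed
  also have "\<dots> = 2 * (a * a)" using a5 by (simp add: algebra_simps le_add_diff_inverse2 diff_mult_distrib2)
  finally have 1: "(\<Sum>i=2..a - 1. K i) \<le> a * a" by simp
  have "{..<a} = {0, 1} \<union> {2..a - 1}" using a5 by auto
  then have "(\<Sum>i<a. K i) = (\<Sum>i\<in>{0, 1}. K i) + (\<Sum>i=2..a - 1. K i)"
    by (simp only:) (rule sum.union_disjoint; auto)
  \<comment> \<open>Distance 1 adds at most \<open>2 * a\<close> arcs and distance 3 none, so there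
    are at most \<open>a * (a + 2)\<close> arcs, against \<open>degree_excess\<close>.\<close>
  also have "\<dots> \<le> 2 * a + a * a" using 1 K1 jumps_le[of f 1] by (simp add: K_def)
  finally have "2 * (\<Sum>i<a. K i) \<le> 2 * a * (a + 2)" by (simp add: algebra_simps)
  then show False using sum_jumps[OF f] degree_excess[OF a5] by (simp add: K_def)
qed

text \<open>For \<open>a = 4\<close> the count determines the digraph.\<close>
lemma near_hamiltonian_small:
  assumes f: "spanning_cycle E V f" and a4: "a = 4"
  shows near_hamiltonian
proof (rule ccontr)
  assume non: "\<not> near_hamiltonian"
  have k2: "k = 2" using k_ge k_le a4 by simp
  have fac: "cycle_factor E V f" using f by (simp add: spanning_cycle_def)
  have J3: "jumps f 3 = 0" using near_hamiltonian_of_jump3[OF f] non by blast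
  have "(\<Sum>v\<in>V. 6) \<le> (\<Sum>v\<in>V. deg E v)" by (rule sum_mono) (use deg_ge a4 k2 in force)
  then have "48 \<le> (\<Sum>v\<in>V. deg E v)" by (simp add: card_V a4)
  \<comment> \<open>Each of the four numbers is at most 8 and the one for distance 3 is 0, so 24
    arcs fill the distances 1, 5 and 7 completely.\<close>
  then have "24 \<le> jumps f 1 + jumps f 3 + jumps f 5 + jumps f 7"
  proof -
    have "{..<4} = {0, 1, 2, 3::nat}" by auto
    then show ?thesis using sum_jumps[OF f] \<open>48 \<le> _\<close> by (simp add: a4)
  qed
  then have J: "jumps f 5 = card V" "jumps f 7 = card V"
    using jumps_le[of f 1] jumps_le[of f 5] jumps_le[of f 7] J3 by (simp_all add: card_V a4)
  have full: "E v ((f ^^ t) v)" if "jumps f t = card V" "v \<in> V" for t v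
  proof -
    have "{v \<in> V. E v ((f ^^ t) v)} = V"
      by (rule card_subset_eq[OF finV]) (use that in \<open>auto simp: jumps_def\<close>)
    then show ?thesis using that by blast
  qed
  have "V \<noteq> {}" using card_V a4 by (metis card.empty mult_eq_0_iff zero_neq_numeral)
  then obtain z where z: "z \<in> V" by blast
  define r where "r = (\<lambda>i. (f ^^ i) z)"
  have inj: "inj_on r {..<8}" and ran: "r ` {..<8} = V"
    using spanning_cycle_inj_on[OF f finV z] spanning_cycle_range[OF f finV z] by (simp_all add: r_def card_V a4)
  have per: "r (i + 8) = r i" for i
    using spanning_cycle_period[OF f finV z] by (simp add: r_def card_V a4 funpow_add)
  have rV: "r i \<in> V" for i using funpow_mem[OF fac z] by (simp add: r_def)
  have add: "(f ^^ t) (r i) = r (t + i)" for t i by (simp add: r_def funpow_add)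
  have E1: "E (r i) (r (Suc i))" for i
    using funpow_mem[OF fac z, of i] fac by (simp add: r_def cycle_factor_def)
  have E5: "E (r i) (r (5 + i))" for i using full[OF J(1) rV[of i]] by (simp only: add)
  have E7: "E (r i) (r (7 + i))" for i using full[OF J(2) rV[of i]] by (simp only: add)
  \<comment> \<open>Steps of length 1, 1, 5, 5, 7, 5 modulo 8 give a 6-cycle that avoids the
    consecutive vertices 5 and 6.\<close>
  define s where "s = (\<lambda>i. r ([0, 1, 2, 7, 4, 3] ! i))"
  have "\<exists>g. spanning_cycle E (s ` {..<6}) g"
  proof (rule spanning_cycle_of_seq)
    show "inj_on s {..<6}"
    proof (rule inj_onI)
      fix i j assume ij: "i \<in> {..<6}" "j \<in> {..<6}" "s i = s j"
      have "set [0, 1, 2, 7, 4, 3::nat] \<subseteq> {..<8}" by simp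
      then have "[0, 1, 2, 7, 4, 3] ! n \<in> {..<8::nat}" if "n < 6" for n :: nat
        using nth_mem[of n "[0, 1, 2, 7, 4, 3::nat]"] that by auto
      then have "[0, 1, 2, 7, 4, 3] ! i = [0, 1, 2, 7, 4, 3::nat] ! j"
        using ij by (intro inj_onD[OF inj]) (auto simp: s_def)
      moreover have "distinct [0, 1, 2, 7, 4, 3::nat]" by simp
      ultimately show "i = j" using ij nth_eq_iff_index_eq[of "[0, 1, 2, 7, 4, 3::nat]" i j] by simp
    qed
    have "E (r 0) (r 1)" "E (r 1) (r 2)" "E (r 2) (r 7)" "E (r 7) (r 4)" "E (r 4) (r 3)" "E (r 3) (r 0)"
      using E1[of 0] E1[of 1] E5[of 2] E5[of 7] per[of 4] E7[of 4] per[of 3] E5[of 3] per[of 0]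
      by (simp_all add: numeral_2_eq_2)
    then show "E (s i) (s (Suc i))" if "Suc i < 6" for i
    proof -
      have "i \<in> {0, 1, 2, 3, 4}" using that by auto
      then show ?thesis using \<open>E (r 0) (r 1)\<close> \<open>E (r 1) (r 2)\<close> \<open>E (r 2) (r 7)\<close> \<open>E (r 7) (r 4)\<close> \<open>E (r 4) (r 3)\<close>
        by (auto simp: s_def)
    qed
    show "E (s (6 - 1)) (s 0)" using \<open>E (r 3) (r 0)\<close> by (simp add: s_def)
  qed simp
  moreover have "s ` {..<6} = V - {r 5, r 6}"
  proof -
    have "s ` {..<6} = r ` {0, 1, 2, 7, 4, 3}"
    proof -
      have "{..<6} = {0, 1, 2, 3, 4, 5::nat}" by auto
      then show ?thesis by (simp add: s_def)
    qed
    also have "{0, 1, 2, 7, 4, 3} = {..<8} - {5, 6::nat}" by auto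
    also have "r ` \<dots> = V - {r 5, r 6}"
      using inj_on_image_set_diff[OF inj, of "{..<8}" "{5, 6}"] ran by simp
    finally show ?thesis .
  qed
  moreover have "r 5 \<in> X \<longleftrightarrow> r 6 \<notin> X"
    using funpow_side[OF fac z, of 5] funpow_side[OF fac z, of 6] by (simp add: r_def)
  ultimately have near_hamiltonian unfolding near_hamiltonian_def using rV[of 5] rV[of 6] disj
    by (metis Un_iff insert_commute)
  then show False using non by blast
qed

lemma near_hamiltonian: near_hamiltonian
proof -
  obtain f where "spanning_cycle E V f" using hamiltonian by blast
  moreover have "a = 4 \<or> 5 \<le> a" using k_ge k_le by linarith
  ultimately show ?thesis using near_hamiltonian_large near_hamiltonian_small by blast
qed

text \<open>By counting, some out-neighbour of the missed vertex is followed at distance \<open>2 l - 2\<close> on the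
  cycle by an in-neighbour.\<close>
lemma short_cycles:
  assumes l: "1 \<le> l" "l \<le> a - 1"
  shows "has_cycle (2 * l)"
proof -
  interpret sw: dominated_bipartite E Y X a k by (rule swap)
  obtain x y g where x: "x \<in> X" and y: "y \<in> Y" and g: "spanning_cycle E (V - {x, y}) g"
    using near_hamiltonian by (auto simp: near_hamiltonian_def)
  let ?C = "V - {x, y}"
  have fac: "cycle_factor E ?C g" using g by (simp add: spanning_cycle_def)
  have CY: "?C \<inter> Y = Y - {y}" using x disj by blast
  have cC: "card ?C = 2 * a - 2"
  proof -
    have "x \<noteq> y" using x y disj by blast
    then show ?thesis using x y card_V finV by (subst card_Diff_subset) auto
  qed
  \<comment> \<open>An even power of \<open>g\<close>, so it preserves \<open>Y\<close>; for
    \<open>l = 1\<close> it is the identity and the cycle will be \<open>x\<close>,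
    \<open>z\<close>.\<close>
  define h where "h = g ^^ (2 * l - 2)"
  have side: "h z \<in> Y - {y}" if "z \<in> Y - {y}" for z
  proof -
    have zC: "z \<in> ?C" using that x disj by blast
    have "h z \<in> ?C" unfolding h_def by (rule funpow_mem[OF fac zC])
    moreover have "h z \<in> Y"
      using sw.funpow_side[OF fac zC, of "2 * l - 2"] that by (auto simp: h_def)
    ultimately show ?thesis by blast
  qed
  let ?O = "{z \<in> Y - {y}. E x z}" and ?I = "{z \<in> Y - {y}. E z x}"
  have "inj_on h ?C" unfolding h_def using bij_betw_funpow[of g ?C] fac
    by (auto simp: cycle_factor_def bij_betw_def)
  then have "inj_on h ?O" by (rule inj_on_subset) (use x disj in auto)
  then have cO: "card (h ` ?O) = card ?O" by (rule card_image)
  have "card {w. E x w} \<le> card (insert y ?O)" "card {w. E w x} \<le> card (insert y ?I)"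
    by (rule card_mono; use nbh_X[OF x] finY in auto)+
  then have "card {w. E x w} \<le> card ?O + 1" "card {w. E w x} \<le> card ?I + 1"
    using finY by (simp_all add: card_insert_if)
  then have "a \<le> card ?O + card ?I" using deg_ge[of x] x k_ge by (simp add: deg_def)
  moreover have "card (h ` ?O \<union> ?I) \<le> card (Y - {y})"
    by (rule card_mono) (use finY side in auto)
  moreover have "card (Y - {y}) = a - 1" using y finY cardY by simp
  moreover have "card (h ` ?O) + card ?I = card (h ` ?O \<union> ?I) + card (h ` ?O \<inter> ?I)"
    using finY by (intro card_Un_Int) auto
  ultimately have "card (h ` ?O \<inter> ?I) \<noteq> 0" using cO l by linarith
  then have "h ` ?O \<inter> ?I \<noteq> {}" by (metis card.empty)
  then obtain z where z: "z \<in> Y - {y}" "E x z" "E (h z) x" by blast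
  have zC: "z \<in> ?C" using z x disj by blast
  \<comment> \<open>The cycle runs through \<open>x\<close>, \<open>z\<close>, \<open>g z\<close>,
    ..., \<open>h z\<close>, which are \<open>2 * l\<close> vertices.\<close>
  define r where "r = (\<lambda>i. case i of 0 \<Rightarrow> x | Suc j \<Rightarrow> (g ^^ j) z)"
  have injz: "inj_on (\<lambda>i. (g ^^ i) z) {..<2 * a - 2}"
    using spanning_cycle_inj_on[OF g _ zC] finV by (simp add: cC)
  have inj: "inj_on r {..<2 * l}"
  proof (rule inj_onI)
    fix i j assume ij: "i \<in> {..<2 * l}" "j \<in> {..<2 * l}" "r i = r j"
    have "(g ^^ n) z \<noteq> x" for n using funpow_mem[OF fac zC, of n] by blast
    then show "i = j" using ij l inj_onD[OF injz] by (auto simp: r_def split: nat.splits)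
  qed
  have "\<exists>f. spanning_cycle E (r ` {..<2 * l}) f"
  proof (rule spanning_cycle_of_seq[OF _ inj])
    show "E (r i) (r (Suc i))" for i
      using z(2) funpow_mem[OF fac zC] fac by (cases i) (auto simp: r_def cycle_factor_def)
    show "E (r (2 * l - 1)) (r 0)"
    proof -
      have "2 * l - 1 = Suc (2 * l - 2)" using l by simp
      then show ?thesis using z(3) by (simp add: r_def h_def)
    qed
  qed (use l in auto)
  moreover have "r ` {..<2 * l} \<subseteq> V"
  proof
    fix v assume "v \<in> r ` {..<2 * l}"
    then obtain i where "v = r i" by blast
    then show "v \<in> V" using x funpow_mem[OF fac zC, of "i - 1"] by (cases i) (auto simp: r_def)
  qed
  moreover have "card (r ` {..<2 * l}) = 2 * l" using inj by (simp add: card_image)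
  ultimately show ?thesis unfolding has_cycle_def by blast
qed

theorem all_even_cycles:
  assumes "even n" "2 \<le> n" "n \<le> 2 * a"
  shows "has_cycle n"
proof -
  obtain l where l: "n = 2 * l" using assms by blast
  show ?thesis
  proof (cases "l = a")
    case True
    then show ?thesis using hamiltonian card_V l unfolding has_cycle_def by blast
  next
    case False
    then show ?thesis using short_cycles[of l] assms l by simp
  qed
qed

end

section \<open>Transfer to digraphs\<close>

lemma (in digraph) bij_betw_head:
  "bij_betw (head G) (out_arcs G v) {w. v \<rightarrow> w}"
proof -
  have "inj_on (head G) (out_arcs G v)"
    using no_multi_arcs by (auto simp: inj_on_def arc_to_ends_def)
  then show ?thesis by (auto simp: bij_betw_def arcs_ends_conv)
qed

lemma (in digraph) bij_betw_tail:
  "bij_betw (tail G) (in_arcs G v) {w. w \<rightarrow> v}"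
proof -
  have "inj_on (tail G) (in_arcs G v)"
    using no_multi_arcs by (auto simp: inj_on_def arc_to_ends_def)
  then show ?thesis by (auto simp: bij_betw_def arcs_ends_conv)
qed

lemma (in digraph) total_degree_eq: "total_degree G v = deg (dominates G) v"
  using bij_betw_same_card[OF bij_betw_head[of v]] bij_betw_same_card[OF bij_betw_tail[of v]]
  by (simp add: total_degree_def deg_def out_degree_def in_degree_def)

lemma (in wf_digraph) strong_arc_leaving:
  assumes "strongly_connected G" "S \<subseteq> verts G" "S \<noteq> {}" "S \<noteq> verts G"
  shows "\<exists>u\<in>S. \<exists>v\<in>verts G - S. u \<rightarrow> v"
proof (rule ccontr)
  assume neg: "\<not> ?thesis"
  obtain u v where uv: "u \<in> S" "v \<in> verts G - S" using assms by blast
  then have "u \<rightarrow>\<^sup>* v" using assms by (auto simp: strongly_connected_def)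
  then have "(u, v) \<in> (arcs_ends G)\<^sup>*" by (simp add: reachable_conv)
  then have "v \<in> S"
  proof (induction rule: rtrancl_induct)
    case (step y z)
    moreover have "z \<in> verts G" using step.hyps(2) by (auto simp: arcs_ends_conv)
    ultimately show ?case using neg by blast
  qed (use uv in simp)
  then show False using uv by blast
qed

lemma (in pre_digraph) cas_map_upt:
  assumes "\<And>i. tail G (e i) = s i \<and> head G (e i) = s (Suc i)"
  shows "cas (s m) (map e [m..<m + l]) (s (m + l))"
proof (induction l arbitrary: m)
  case (Suc l)
  have "[m..<m + Suc l] = m # [Suc m..<Suc m + l]" by (simp add: upt_conv_Cons)
  then show ?case using Suc[of "Suc m"] assms[of m] by simp
qed simp

text \<open>The arc list follows the orbit of some vertex through one full period. The clause on
  heads is for the directed cycle case, where it identifies every arc of the digraph with one of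
  \<open>p\<close>.\<close>

lemma (in digraph) ex_cycle_of_spanning:
  assumes f: "spanning_cycle (dominates G) C f" and C: "C \<subseteq> verts G" "C \<noteq> {}"
  shows "\<exists>p. cycle p \<and> length p = card C \<and> tail G ` set p = C \<and>
    (\<forall>a\<in>set p. a \<in> arcs G \<and> head G a = f (tail G a))"
proof -
  have fin: "finite C" using finite_subset[OF C(1)] by simp
  have fac: "bij_betw f C C" "\<And>v. v \<in> C \<Longrightarrow> v \<rightarrow> f v"
    using f by (auto simp: spanning_cycle_def cycle_factor_def)
  obtain z where z: "z \<in> C" using C by blast
  define s where "s = (\<lambda>i. (f ^^ i) z)"
  have sC: "s i \<in> C" for i
    using bij_betw_funpow[OF fac(1), of i] z by (auto simp: s_def bij_betw_def)
  have "\<exists>a. a \<in> arcs G \<and> tail G a = s i \<and> head G a = s (Suc i)" for i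
    using fac(2)[OF sC[of i]] by (auto simp: arcs_ends_conv s_def)
  then obtain e where e: "\<And>i. e i \<in> arcs G \<and> tail G (e i) = s i \<and> head G (e i) = s (Suc i)"
    by metis
  let ?n = "card C"
  define p where "p = map e [0..<?n]"
  have n0: "0 < ?n" using C fin by (simp add: card_gt_0_iff)
  have per: "s ?n = s 0" using spanning_cycle_period[OF f fin z] by (simp add: s_def)
  have cas: "cas z p z"
    using cas_map_upt[of e s 0 ?n] e per by (simp add: p_def s_def)
  have "set p \<subseteq> arcs G" using e by (auto simp: p_def)
  then have "awalk z p z" using cas z C by (auto simp: awalk_def)
  moreover have ne: "p \<noteq> []" using n0 by (simp add: p_def)
  moreover have "distinct (tl (awalk_verts z p))"
  proof -
    have "tl (awalk_verts z p) = map (\<lambda>i. s (Suc i)) [0..<?n]"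
      using awalk_verts_conv'[OF cas] ne e by (simp add: p_def)
    moreover have "f z \<in> C" using sC[of 1] by (simp add: s_def)
    then have "inj_on (\<lambda>i. s (Suc i)) {..<?n}"
      using spanning_cycle_inj_on[OF f fin, of "f z"] by (simp add: s_def funpow_swap1)
    ultimately show ?thesis by (simp add: distinct_map atLeast0LessThan)
  qed
  ultimately have "cycle p" by (auto simp: cycle_def)
  moreover have "tail G ` set p = C"
    using spanning_cycle_range[OF f fin z] e
    by (simp add: p_def image_image s_def atLeast0LessThan)
  moreover have "length p = card C" by (simp add: p_def)
  moreover have "\<forall>a\<in>set p. a \<in> arcs G \<and> head G a = f (tail G a)" using e by (auto simp: p_def s_def)
  ultimately show ?thesis by blast
qed

text \<open>The unique out-neighbour is a function \<open>f\<close>. Strong connectivity makes it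
  onto, since every vertex is entered, hence a permutation, and a proper nonempty closed set of
  \<open>f\<close> would have no arc leaving it.\<close>

lemma (in digraph) directed_cycle_of_unique_out:
  assumes strong: "strongly_connected G" and card: "2 \<le> card (verts G)"
    and uniq: "\<And>u v w. w \<rightarrow> u \<Longrightarrow> w \<rightarrow> v \<Longrightarrow> u = v"
  shows "is_directed_cycle G (card (verts G))"
proof -
  have single: "verts G \<noteq> {v}" for v using card by auto
  have "\<exists>w. v \<rightarrow> w" if "v \<in> verts G" for v
    using strong_arc_leaving[OF strong, of "{v}"] that single[of v] by auto
  then obtain f where f: "\<And>v. v \<in> verts G \<Longrightarrow> v \<rightarrow> f v" by metis
  have fV: "f v \<in> verts G" if "v \<in> verts G" for v using f[OF that] by (auto simp: arcs_ends_conv)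
  have "\<exists>u\<in>verts G. v = f u" if "v \<in> verts G" for v
  proof -
    have "verts G - {v} \<noteq> {}" "verts G - {v} \<noteq> verts G" using that single[of v] by blast+
    then obtain u w where u: "u \<in> verts G" "w \<in> verts G - (verts G - {v})" "u \<rightarrow> w"
      using strong_arc_leaving[OF strong, of "verts G - {v}"] by blast
    then have "v = f u" using uniq[OF _ f[OF u(1)], of v] by auto
    then show ?thesis using u(1) by blast
  qed
  then have "f ` verts G = verts G" using fV by blast
  then have "bij_betw f (verts G) (verts G)" by (simp add: bij_betw_def eq_card_imp_inj_on)
  moreover have "S = {} \<or> S = verts G" if S: "S \<in> closed_sets f (verts G)" for S
  proof (rule ccontr)
    assume "\<not> ?thesis"
    moreover have "S \<subseteq> verts G" "f ` S \<subseteq> S" using S by (auto simp: closed_sets_def)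
    ultimately obtain u v where uv: "u \<in> S" "v \<in> verts G - S" "u \<rightarrow> v" "u \<in> verts G" "f u \<in> S"
      using strong_arc_leaving[OF strong, of S] by blast
    then show False using uniq[OF uv(3) f[OF uv(4)]] by blast
  qed
  ultimately have sp: "spanning_cycle (dominates G) (verts G) f"
    using f by (auto simp: spanning_cycle_def cycle_factor_def)
  have "verts G \<noteq> {}" using card by auto
  then obtain p where p: "cycle p" "length p = card (verts G)" "tail G ` set p = verts G"
    "\<And>a. a \<in> set p \<Longrightarrow> a \<in> arcs G \<and> head G a = f (tail G a)"
    using ex_cycle_of_spanning[OF sp] by blast
  have "arcs G \<subseteq> set p"
  proof
    fix b assume b: "b \<in> arcs G"
    then have "tail G b \<in> tail G ` set p" using p(3) by simp
    then obtain c where c: "c \<in> set p" "tail G c = tail G b" by auto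
    have "tail G b \<rightarrow> head G b" using b by (auto simp: arcs_ends_conv)
    then have "head G b = f (tail G b)" using uniq f[OF tail_in_verts[OF b]] by blast
    then have "arc_to_ends G b = arc_to_ends G c" using c p(4)[OF c(1)] by (simp add: arc_to_ends_def)
    then have "b = c" using no_multi_arcs b p(4)[OF c(1)] by blast
    then show "b \<in> set p" using c(1) by simp
  qed
  then show ?thesis using p unfolding is_directed_cycle_def by blast
qed

theorem theorem5p1:
  fixes D :: "('a, 'b) pre_digraph" and a :: nat and k :: int
  assumes "digraph D"
    and "strongly_connected D"
    and "balanced_bipartite D"
    and "card (verts D) = 2 * a"
    and "a \<ge> 3"
    and "max 1 (real a / 4) < real_of_int k"
    and "real_of_int k \<le> real a / 2"
    and "\<And>u v. dominated_pair D u v \<Longrightarrow>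
           int (total_degree D u) \<ge> 2 * int a - k \<and> int (total_degree D v) \<ge> int a + k \<or>
           int (total_degree D u) \<ge> int a + k \<and> int (total_degree D v) \<ge> 2 * int a - k"
  shows "bipancyclic D \<or> is_directed_cycle D (2 * a)"
proof -
  interpret digraph D by fact
  let ?E = "dominates D"
  obtain X Y where XY: "verts D = X \<union> Y" "X \<inter> Y = {}" "card X = card Y"
    and bipD: "\<forall>e\<in>arcs D. tail D e \<in> X \<and> head D e \<in> Y \<or> tail D e \<in> Y \<and> head D e \<in> X"
    using assms(3) by (auto simp: balanced_bipartite_def)
  have bip: "u \<in> X \<and> v \<in> Y \<or> u \<in> Y \<and> v \<in> X" if "?E u v" for u v
    using that bipD by (auto simp: arcs_ends_conv)
  have fin: "finite X" "finite Y" using XY(1) finite_verts by (metis finite_Un)+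
  then have cards: "card X = a" "card Y = a"
    using assms(4) XY card_Un_disjoint[of X Y] by auto
  have k: "2 \<le> k" "2 * k \<le> int a" using assms(6,7) by auto
  have kn: "int (nat k) = k" using k by simp
  have degs: "a + nat k \<le> deg ?E u \<and> a + nat k \<le> deg ?E v \<and>
      (2 * a - nat k \<le> deg ?E u \<or> 2 * a - nat k \<le> deg ?E v)"
    if "?E w u" "?E w v" "u \<noteq> v" for u v w
  proof -
    have "dominated_pair D u v" using that by (auto simp: dominated_pair_def)
    from assms(8)[OF this] show ?thesis using k unfolding total_degree_eq by linarith
  qed
  define B where "B = {v \<in> verts D. \<forall>w u. ?E w v \<longrightarrow> ?E w u \<longrightarrow> u = v}"
  show ?thesis
  proof (cases "B = {}")
    case True
    have deg_ge: "a + nat k \<le> deg ?E v" if "v \<in> verts D" for v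
      using that True degs unfolding B_def by blast
    interpret dominated_bipartite ?E X Y a "nat k"
    proof
      show "\<exists>u\<in>S. \<exists>v\<in>X \<union> Y - S. ?E u v" if "S \<subseteq> X \<union> Y" "S \<noteq> {}" "S \<noteq> X \<union> Y" for S
        using strong_arc_leaving[OF assms(2), of S] that XY(1) by simp
    qed (use fin XY cards bip degs deg_ge k in auto)
    have "\<exists>p. cycle p \<and> length p = n" if "even n \<and> 2 \<le> n \<and> n \<le> card (verts D)" for n
    proof -
      have "has_cycle n" by (rule all_even_cycles) (use that assms(4) in auto)
      then obtain C f where C: "C \<subseteq> verts D" "card C = n" "spanning_cycle ?E C f"
        unfolding has_cycle_def XY(1) by blast
      moreover have "C \<noteq> {}" using C that by auto
      ultimately show ?thesis using ex_cycle_of_spanning[of C f] by blast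
    qed
    then show ?thesis unfolding bipancyclic_def by blast
  next
    case False
    have "B = verts D"
    proof (rule ccontr)
      assume "B \<noteq> verts D"
      moreover have BV: "B \<subseteq> verts D" by (auto simp: B_def)
      ultimately have "verts D - B \<noteq> {}" "verts D - B \<noteq> verts D" using False by blast+
      then obtain u v where uv: "u \<in> verts D - B" "v \<in> B" "?E u v"
        using strong_arc_leaving[OF assms(2), of "verts D - B"] by blast
      \<comment> \<open>Outside \<open>B\<close> degrees are at least \<open>a + k\<close>, but
        \<open>u\<close> has \<open>v\<close> as its only out-neighbour and thus degree at most
        \<open>a + 1\<close>.\<close>
      have "{w. ?E u w} \<subseteq> {v}" using uv by (auto simp: B_def)
      then have "card {w. ?E u w} \<le> 1" using card_mono[of "{v}" "{w. ?E u w}"] by simp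
      moreover have "card {w. ?E w u} \<le> a"
      proof -
        have "{w. ?E w u} \<subseteq> X \<or> {w. ?E w u} \<subseteq> Y" using bip XY(2) by blast
        then show ?thesis using fin cards card_mono by metis
      qed
      moreover have "a + nat k \<le> deg ?E u" using uv(1) degs unfolding B_def by blast
      ultimately show False using k by (simp add: deg_def)
    qed
    then have "u = v" if "?E w u" "?E w v" for u v w
    proof -
      have "v \<in> B" using \<open>B = verts D\<close> that(2) by (auto simp: arcs_ends_conv)
      then show ?thesis using that unfolding B_def by blast
    qed
    then show ?thesis
      using directed_cycle_of_unique_out[OF assms(2)] assms(4,5) by simp
  qed
qed

end
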